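(* Let $\{\mathbf n=\mathbf v\oplus\mathbf z,\langle\,,\rangle,\mathbf J_Z\}$ be a metric 2-step nilpotent Lie algebra, let $\sigma$ be an involutive orthogonal transformation of $\mathbf v$ commuting with every $\mathbf J_Z$, $Z\in\mathbf z$, and let $\mathbf n_\sigma=\{\mathbf v\oplus\mathbf z,\langle\,,\rangle,\sigma\mathbf J_Z\}$ be the $\sigma$-deformed Lie algebra. Let $(N,g)$ and $(N_\sigma,g^\sigma)$ be the corresponding Lie groups with left-invariant metrics. Then the Laplacians of $(N,g)$ and $(N_\sigma,g^\sigma)$ acting on the left-invariant 1-forms are isospectral, and so are the Laplacians acting on the left-invariant 2-forms.
   Context: A metric 2-step nilpotent Lie algebra is a system $\{\mathbf n=\mathbf v\oplus\mathbf z,\langle\,,\rangle,\mathbf J_Z\}$ (finite-dimensional, real), where $\mathbf z=[\mathbf n,\mathbf n]$ is the center, $\langle\,,\rangle$ is an inner product with $\mathbf v\perp\mathbf z$, and the injective linear map $\mathbf J:\mathbf z\to \mathrm{End}(\mathbf v)$ (with skew-symmetric values) is given by $\langle \mathbf J_Z(X),Y\rangle=\langle[X,Y],Z\rangle$; conversely the bracket is determined by $\mathbf J$. The corresponding Lie group is $\mathbf v\oplus\mathbf z$ with product $(X,Z)(X',Z')=(X+X',Z+Z'+\tfrac12[X,X'])$, with the left-invariant metric extending $\langle\,,\rangle$ from the tangent space at the origin. The Laplacian on forms is $\Delta=-(d\delta+\delta d)$, where $\delta$ is the codifferential; it maps the finite-dimensional space of left-invariant $p$-forms to itself. Isospectral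 means that the restricted operators have the same eigenvalues with the same multiplicities. *)

theory Defs
  imports "HOL-Analysis.Analysis" "HOL-Library.Function_Algebras"
begin

section \<open>Functions as a real vector space\<close>

text \<open>Forms are functions.  With this instance \<open>linear\<close>, \<open>span\<close> and \<open>dim\<close> apply to spaces of forms.\<close>

instantiation "fun" :: (type, real_vector) real_vector
begin

definition scaleR_fun_def: "scaleR c f = (\<lambda>x. c *\<^sub>R f x)"

instance
  by standard (simp_all add: scaleR_fun_def fun_eq_iff scaleR_add_left scaleR_add_right)

end

section \<open>Metric 2-step nilpotent Lie algebras\<close>

text \<open>The underlying inner product space is the orthogonal sum \<open>'v \<times> 'z\<close>.  The bracket is the one
  determined by \<open>J\<close>; see \<open>lie_bracket_inner\<close> below.\<close>

definition lie_bracket ::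
  "('z::euclidean_space \<Rightarrow> 'v::euclidean_space \<Rightarrow> 'v) \<Rightarrow> 'v \<times> 'z \<Rightarrow> 'v \<times> 'z \<Rightarrow> 'v \<times> 'z" where
  "lie_bracket J x y = (0, \<Sum>b\<in>Basis. (J b (fst x) \<bullet> fst y) *\<^sub>R b)"

definition metric_2step ::
  "('z::euclidean_space \<Rightarrow> 'v::euclidean_space \<Rightarrow> 'v) \<Rightarrow> bool" where
  "metric_2step J \<longleftrightarrow>
     (\<forall>X. linear (\<lambda>Z. J Z X)) \<and> (\<forall>Z. linear (J Z)) \<and>
     (\<forall>Z X Y. J Z X \<bullet> Y = - (X \<bullet> J Z Y)) \<and>
     inj J \<and>
     span {lie_bracket J x y | x y. True} = {0} \<times> UNIV \<and>
     {x. \<forall>y. lie_bracket J x y = 0} = {0} \<times> UNIV"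

definition deformation :: "('v \<Rightarrow> 'v) \<Rightarrow> ('z \<Rightarrow> 'v \<Rightarrow> 'v) \<Rightarrow> 'z \<Rightarrow> 'v \<Rightarrow> 'v" where
  "deformation \<sigma> J = (\<lambda>Z. \<sigma> \<circ> J Z)"

section \<open>Riemannian metrics and forms on a vector space\<close>

text \<open>A tensor field assigns to a point a function of a list of tangent vectors.  A \<open>p\<close>-form only
  sees lists of length \<open>p\<close> and is set to zero on all other lists, so that forms are determined by
  their values on \<open>p\<close>-tuples.\<close>

definition alternating_forms :: "nat \<Rightarrow> ('n::euclidean_space list \<Rightarrow> real) set" where
  "alternating_forms p = {\<alpha>.
     (\<forall>vs. length vs \<noteq> p \<longrightarrow> \<alpha> vs = 0) \<and>
     (\<forall>vs i. length vs = p \<and> i < p \<longrightarrow> linear (\<lambda>v. \<alpha> (vs[i := v]))) \<and>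
     (\<forall>vs. length vs = p \<and> \<not> distinct vs \<longrightarrow> \<alpha> vs = 0)}"

abbreviation dir_deriv ::
  "('n::euclidean_space \<Rightarrow> 'b::real_normed_vector) \<Rightarrow> 'n \<Rightarrow> 'n \<Rightarrow> 'b" where
  "dir_deriv f x u \<equiv> frechet_derivative f (at x) u"

text \<open>The arguments are extended to constant vector fields, which commute.\<close>

definition ext_deriv ::
  "('n::euclidean_space \<Rightarrow> 'n list \<Rightarrow> real) \<Rightarrow> 'n \<Rightarrow> 'n list \<Rightarrow> real" where
  "ext_deriv \<omega> x vs =
     (\<Sum>i<length vs. (-1) ^ i * dir_deriv (\<lambda>y. \<omega> y (take i vs @ drop (Suc i) vs)) x (vs ! i))"

definition pullback ::
  "('n::euclidean_space \<Rightarrow> 'n) \<Rightarrow> ('n \<Rightarrow> 'n list \<Rightarrow> real) \<Rightarrow> 'n \<Rightarrow> 'n list \<Rightarrow> real" where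
  "pullback f \<omega> x vs = \<omega> (f x) (map (dir_deriv f x) vs)"

definition sharp ::
  "('n::euclidean_space \<Rightarrow> 'n \<Rightarrow> 'n \<Rightarrow> real) \<Rightarrow> 'n \<Rightarrow> ('n \<Rightarrow> real) \<Rightarrow> 'n" where
  "sharp g x \<phi> = (THE w. \<forall>y. g x w y = \<phi> y)"

text \<open>The Levi-Civita connection applied to constant vector fields, by the Koszul formula.\<close>

definition christoffel ::
  "('n::euclidean_space \<Rightarrow> 'n \<Rightarrow> 'n \<Rightarrow> real) \<Rightarrow> 'n \<Rightarrow> 'n \<Rightarrow> 'n \<Rightarrow> 'n" where
  "christoffel g x u v = sharp g x (\<lambda>w.
     (dir_deriv (\<lambda>y. g y v w) x u + dir_deriv (\<lambda>y. g y u w) x v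
       - dir_deriv (\<lambda>y. g y u v) x w) / 2)"

definition cov_deriv ::
  "('n::euclidean_space \<Rightarrow> 'n \<Rightarrow> 'n \<Rightarrow> real) \<Rightarrow> 'n \<Rightarrow> ('n \<Rightarrow> 'n list \<Rightarrow> real) \<Rightarrow>
   'n \<Rightarrow> 'n list \<Rightarrow> real" where
  "cov_deriv g u \<omega> x vs =
     dir_deriv (\<lambda>y. \<omega> y vs) x u - (\<Sum>i<length vs. \<omega> x (vs[i := christoffel g x u (vs ! i)]))"

text \<open>The codifferential is minus the divergence: \<open>sharp g x (\<lambda>y. b \<bullet> y)\<close> is the vector obtained by
  raising the index of the coordinate covector \<open>dx\<^sup>b\<close>, so this is the trace
  \<open>- g\<^sup>i\<^sup>j (\<nabla>\<^sub>i \<omega>)\<^sub>j\<^sub>\<dots>\<close>, i.e. \<open>- \<Sum>\<^sub>i (\<nabla> \<^bsub>E\<^sub>i\<^esub> \<omega>) (E\<^sub>i, \<dots>)\<close> for a \<open>g\<close>-orthonormal frame \<open>E\<^sub>i\<close>.\<close>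

definition codifferential ::
  "('n::euclidean_space \<Rightarrow> 'n \<Rightarrow> 'n \<Rightarrow> real) \<Rightarrow> ('n \<Rightarrow> 'n list \<Rightarrow> real) \<Rightarrow>
   'n \<Rightarrow> 'n list \<Rightarrow> real" where
  "codifferential g \<omega> x vs =
     - (\<Sum>b\<in>Basis. cov_deriv g b \<omega> x (sharp g x (\<lambda>y. b \<bullet> y) # vs))"

definition laplacian ::
  "('n::euclidean_space \<Rightarrow> 'n \<Rightarrow> 'n \<Rightarrow> real) \<Rightarrow> ('n \<Rightarrow> 'n list \<Rightarrow> real) \<Rightarrow>
   'n \<Rightarrow> 'n list \<Rightarrow> real" where
  "laplacian g \<omega> = - (ext_deriv (codifferential g \<omega>) + codifferential g (ext_deriv \<omega>))"

section \<open>The Lie group and its left-invariant metric and forms\<close>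

text \<open>On pairs this reads \<open>(X, Z) (X', Z') = (X + X', Z + Z' + [X, X'] / 2)\<close>, with inverse
  \<open>(X, Z)\<^sup>-\<^sup>1 = (-X, -Z)\<close> when \<open>J\<close> is skew.\<close>

definition group_mult ::
  "('z::euclidean_space \<Rightarrow> 'v::euclidean_space \<Rightarrow> 'v) \<Rightarrow> 'v \<times> 'z \<Rightarrow> 'v \<times> 'z \<Rightarrow> 'v \<times> 'z" where
  "group_mult J a x = a + x + (1 / 2) *\<^sub>R lie_bracket J a x"

definition left_invariant_metric ::
  "('z::euclidean_space \<Rightarrow> 'v::euclidean_space \<Rightarrow> 'v) \<Rightarrow>
   'v \<times> 'z \<Rightarrow> 'v \<times> 'z \<Rightarrow> 'v \<times> 'z \<Rightarrow> real" where
  "left_invariant_metric J x u v =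
     dir_deriv (group_mult J (- x)) x u \<bullet> dir_deriv (group_mult J (- x)) x v"

text \<open>Smoothness is not required: it follows from invariance, since the group acts smoothly and
  transitively.\<close>

definition left_invariant_forms ::
  "('z::euclidean_space \<Rightarrow> 'v::euclidean_space \<Rightarrow> 'v) \<Rightarrow> nat \<Rightarrow>
   ('v \<times> 'z \<Rightarrow> ('v \<times> 'z) list \<Rightarrow> real) set" where
  "left_invariant_forms J p =
     {\<omega>. (\<forall>x. \<omega> x \<in> alternating_forms p) \<and> (\<forall>a. pullback (group_mult J a) \<omega> = \<omega>)}"

section \<open>Isospectrality\<close>

definition eigenspace_on :: "'a::real_vector set \<Rightarrow> ('a \<Rightarrow> 'a) \<Rightarrow> real \<Rightarrow> 'a set" where
  "eigenspace_on V T l = {f \<in> V. T f = l *\<^sub>R f}"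

text \<open>Intended for the symmetric operators \<open>laplacian\<close> on finite-dimensional spaces \<open>V\<close>, \<open>W\<close>: real
  eigenvalues suffice, and multiplicities are dimensions of eigenspaces.\<close>

definition isospectral_on ::
  "'a::real_vector set \<Rightarrow> ('a \<Rightarrow> 'a) \<Rightarrow> 'b::real_vector set \<Rightarrow> ('b \<Rightarrow> 'b) \<Rightarrow> bool" where
  "isospectral_on V T W S \<longleftrightarrow>
     (\<forall>l. ((\<exists>f\<in>V. f \<noteq> 0 \<and> T f = l *\<^sub>R f) \<longleftrightarrow> (\<exists>f\<in>W. f \<noteq> 0 \<and> S f = l *\<^sub>R f)) \<and>
          dim (eigenspace_on V T l) = dim (eigenspace_on W S l))"

section \<open>Basic facts\<close>

lemma lie_bracket_inner:
  assumes "\<And>X. linear (\<lambda>Z. J Z X)"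
  shows "J Z X \<bullet> Y = lie_bracket J (X, A) (Y, B) \<bullet> (0, Z)"
proof -
  have "J Z X = J (\<Sum>b\<in>Basis. (Z \<bullet> b) *\<^sub>R b) X"
    by (simp add: euclidean_representation)
  also have "\<dots> = (\<Sum>b\<in>Basis. (Z \<bullet> b) *\<^sub>R J b X)"
    using linear_sum[OF assms[of X], of "\<lambda>b. (Z \<bullet> b) *\<^sub>R b" Basis]
      linear_scale[OF assms[of X]] by simp
  finally show ?thesis
    by (simp add: lie_bracket_def inner_sum_left inner_sum_right inner_commute mult.commute)
qed

lemma lie_bracket_deformation:
  assumes "\<And>Z. \<sigma> \<circ> J Z = J Z \<circ> \<sigma>"
  shows "lie_bracket (deformation \<sigma> J) x y = lie_bracket J (\<sigma> (fst x), snd x) y"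
  using assms by (simp add: lie_bracket_def deformation_def fun_eq_iff)

lemma metric_2step_deformation:
  assumes J: "metric_2step J"
    and orth: "orthogonal_transformation \<sigma>" and inv: "\<sigma> \<circ> \<sigma> = id"
    and comm: "\<And>Z. \<sigma> \<circ> J Z = J Z \<circ> \<sigma>"
  shows "metric_2step (deformation \<sigma> J)"
proof -
  have [simp]: "\<sigma> (\<sigma> X) = X" "\<sigma> (J Z X) = J Z (\<sigma> X)" for X Z
    using inv comm by (simp_all add: fun_eq_iff)
  have lin: "linear \<sigma>"
    using orth by (rule orthogonal_transformation_linear)
  have sym: "\<sigma> X \<bullet> Y = X \<bullet> \<sigma> Y" for X Y
    using orth unfolding orthogonal_transformation_def by (metis \<open>\<And>X. \<sigma> (\<sigma> X) = X\<close>)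
  have br: "lie_bracket (deformation \<sigma> J) x y = lie_bracket J (\<sigma> (fst x), snd x) y" for x y
    by (rule lie_bracket_deformation[OF comm])
  have "linear (\<lambda>Z. deformation \<sigma> J Z X)" for X
    using J linear_compose[OF _ lin, of "\<lambda>Z. J Z X"]
    by (simp add: metric_2step_def deformation_def o_def)
  moreover have "linear (deformation \<sigma> J Z)" for Z
    using J linear_compose[OF _ lin, of "J Z"] by (simp add: metric_2step_def deformation_def)
  moreover have "deformation \<sigma> J Z X \<bullet> Y = - (X \<bullet> deformation \<sigma> J Z Y)" for X Y Z
    using J sym[of X "J Z Y"] by (simp add: metric_2step_def deformation_def)
  moreover have "inj (deformation \<sigma> J)"
  proof (rule injI)
    fix Z W assume eq: "deformation \<sigma> J Z = deformation \<sigma> J W"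
    have "J Z X = J W X" for X
      using fun_cong[OF eq, of "\<sigma> X"] by (simp add: deformation_def)
    then have "J Z = J W"
      by (simp add: fun_eq_iff)
    then show "Z = W"
      using J unfolding metric_2step_def by (meson injD)
  qed
  moreover have "{lie_bracket (deformation \<sigma> J) x y | x y. True} = {lie_bracket J x y | x y. True}"
  proof -
    have "\<exists>x' y'. lie_bracket J x y = lie_bracket (deformation \<sigma> J) x' y'" for x y
      unfolding br by (rule exI[of _ "(\<sigma> (fst x), snd x)"], rule exI[of _ y]) simp
    then show ?thesis
      unfolding br by blast
  qed
  moreover have "{x. \<forall>y. lie_bracket (deformation \<sigma> J) x y = 0} = {0} \<times> UNIV"
  proof -
    have "(\<forall>y. lie_bracket J x y = 0) \<longleftrightarrow> fst x = 0" for x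
    proof -
      have "x \<in> {x. \<forall>y. lie_bracket J x y = 0} \<longleftrightarrow> x \<in> {0} \<times> UNIV"
        using J by (simp only: metric_2step_def)
      then show ?thesis
        by (cases x) auto
    qed
    moreover have "\<sigma> X = 0 \<longleftrightarrow> X = 0" for X
      using linear_0[OF lin] by (metis \<open>\<And>X. \<sigma> (\<sigma> X) = X\<close>)
    ultimately show ?thesis
      unfolding br by auto
  qed
  ultimately show ?thesis
    using J unfolding metric_2step_def by simp
qed

end

theory Submission
  imports Defs
begin

text \<open>A left-invariant form is determined by its value at the origin, so on such forms the
  Laplacian is an operator on the alternating forms of \<open>\<vv> \<oplus> \<zz>\<close>.  In the left-invariant frame it
  can be written down: \<open>d\<close> acts by \<open>d\<alpha>(u, v) = - \<alpha>([u, v])\<close> and the corresponding formula in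
  degree two, and the Koszul formula for the Levi-Civita connection gives \<open>\<delta> = 0\<close> on 1-forms and
  \<open>(\<delta>\<alpha>)(u) = - (1/2) \<Sum>\<^sub>e \<alpha>(e, J\<^sub>u e)\<close> on 2-forms, where \<open>e\<close> runs through an orthonormal basis of
  \<open>\<vv>\<close> and \<open>J\<^sub>u\<close> only depends on the \<open>\<zz>\<close>-component of \<open>u\<close>; on 3-forms \<open>\<delta>\<close> is given by the same
  trace with one further argument, antisymmetrised.

  Consequently \<open>\<delta>d\<close> is made of traces over \<open>\<vv>\<close> in which \<open>J\<close> occurs twice, once from the bracket and
  once from \<open>\<delta>\<close>.  Replacing \<open>J\<close> by \<open>\<sigma>J\<close> puts a \<open>\<sigma>\<close> on both copies of \<open>e\<close>, and the trace is unchanged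
  because \<open>\<sigma>\<close> is orthogonal.  This settles 1-forms: the two operators coincide
  (\<open>lie_laplacian_1\<close>).

  On 2-forms the remaining part \<open>d\<delta>\<close> lives on \<open>\<Lambda>\<^sup>2 \<vv>\<close>, which the inner product identifies with the skew
  endomorphisms of \<open>\<vv>\<close>.  Split \<open>\<vv>\<close> into the eigenspaces \<open>\<vv>\<^sub>+\<close> and \<open>\<vv>\<^sub>-\<close> of \<open>\<sigma>\<close>.  Each \<open>J\<^sub>Z\<close> is block diagonal, and
  \<open>\<sigma>J\<^sub>Z\<close> arises from it by changing the sign of the block on \<open>\<vv>\<^sub>-\<close>.  Hence the operator on 2-forms
  that changes the sign of the component in \<open>\<Lambda>\<^sup>2 \<vv>\<^sub>-\<close> and fixes all other components,
  \<open>\<alpha> \<mapsto> \<alpha> - 2 \<alpha>(P \<cdot>, P \<cdot>)\<close> with \<open>P\<close> the projection onto \<open>\<vv>\<^sub>-\<close>, intertwines the two copies of \<open>d\<delta>\<close>.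
  It also intertwines \<open>\<delta>d\<close>: the latter is the same operator for both algebras, kills the
  component that changes sign and takes no values there.  So it
  intertwines the two Laplacians (\<open>lie_laplacian_flip\<close>), and being an involution it identifies
  their eigenspaces.\<close>

section \<open>Linear algebra\<close>

lemma linear_real_scale: "linear f \<Longrightarrow> linear (\<lambda>x. c * f x)" for c :: real
  using linear_compose_scale_right[of f c] by simp

lemma linear_left_summand: "linear (\<lambda>X. (X, 0))"
  by (simp add: linear_iff)

lemma bilinear_compose:
  assumes "bilinear B" and "linear f" and "linear g"
  shows "bilinear (\<lambda>X Y. B (f X) (g Y))"
  using assms linear_compose[OF assms(2), of "\<lambda>x. B x y" for y] linear_compose[OF assms(3), of "B x" for x]
  by (simp add: bilinear_def o_def)

lemma bilinear_alternating_antisym: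
  assumes "bilinear B" and "\<And>x. B x x = 0"
  shows "B y x = - (B x y :: real)"
proof -
  have "0 = B (x + y) (x + y)" by (simp add: assms)
  also have "\<dots> = B x y + B y x"
    unfolding bilinear_ladd[OF assms(1)] bilinear_radd[OF assms(1)] by (simp add: assms(2))
  finally show ?thesis by simp
qed

lemma sum_Basis_prod:
  fixes f :: "'a::euclidean_space \<times> 'b::euclidean_space \<Rightarrow> 'c::comm_monoid_add"
  shows "sum f Basis = (\<Sum>e\<in>Basis. f (e, 0)) + (\<Sum>e\<in>Basis. f (0, e))"
  unfolding Basis_prod_def
  by (subst sum.union_disjoint) (auto simp: sum.reindex inj_on_def)

lemma linear_euclidean_expansion:
  fixes f :: "'n::euclidean_space \<Rightarrow> 'b::real_vector"
  assumes "linear f"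
  shows "f v = (\<Sum>b\<in>Basis. (v \<bullet> b) *\<^sub>R f b)"
proof -
  have "f v = f (\<Sum>b\<in>Basis. (v \<bullet> b) *\<^sub>R b)"
    by (simp add: euclidean_representation)
  then show ?thesis
    using assms by (simp add: linear_sum linear_scale)
qed

text \<open>The trace of a bilinear form does not depend on the orthonormal basis; expanding
  \<open>A b\<close> in the basis moves \<open>A\<close> to the other argument as its adjoint.\<close>

lemma trace_adjoint:
  fixes A B :: "'n::euclidean_space \<Rightarrow> 'n" and T :: "'n \<Rightarrow> 'n \<Rightarrow> 'b::real_vector"
  assumes T: "bilinear T" and adj: "\<And>x y. A x \<bullet> y = x \<bullet> B y"
  shows "(\<Sum>b\<in>Basis. T (A b) b) = (\<Sum>b\<in>Basis. T b (B b))"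
proof -
  have "(\<Sum>b\<in>Basis. T (A b) b) = (\<Sum>b\<in>Basis. \<Sum>c\<in>Basis. (B c \<bullet> b) *\<^sub>R T c b)"
    using T linear_euclidean_expansion[of "\<lambda>x. T x b" "A b" for b]
    by (simp add: bilinear_def adj inner_commute[of "B _"])
  also have "\<dots> = (\<Sum>c\<in>Basis. \<Sum>b\<in>Basis. (B c \<bullet> b) *\<^sub>R T c b)"
    by (rule sum.swap)
  also have "\<dots> = (\<Sum>b\<in>Basis. T b (B b))"
    using T linear_euclidean_expansion[of "T c" "B c" for c] by (simp add: bilinear_def)
  finally show ?thesis .
qed

section \<open>Transfer of spectra\<close>

text \<open>Spaces of forms are subspaces of an infinite-dimensional function space, so finite
  dimension of the ambient space cannot be assumed here.\<close>

lemma dim_linear_image: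
  fixes f :: "'a::real_vector \<Rightarrow> 'b::real_vector"
  assumes "linear f" and "inj_on f (span S)"
  shows "dim (f ` S) = dim S"
proof -
  obtain B where B: "B \<subseteq> S" "independent B" "S \<subseteq> span B" "card B = dim S"
    by (rule basis_exists)
  have inj: "inj_on f (span B)"
    using assms(2) span_mono[OF B(1)] by (rule inj_on_subset)
  have "independent (f ` B)"
    using linear_independent_injective_image[OF assms(1) B(2) inj] .
  moreover have "span (f ` B) = span (f ` S)"
    using B(1,3) by (metis assms(1) linear_span_image span_mono span_span subset_antisym)
  moreover have "card (f ` B) = card B"
    using inj span_superset by (metis card_image inj_on_subset)
  ultimately show ?thesis
    using B(4) by (metis dim_eq_card)
qed

text \<open>The space \<open>U\<close> has room for the values of \<open>T\<close>: injectivity of \<open>F\<close> there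
  allows the eigenvalue equation to be pulled back from \<open>W\<close> without first showing that \<open>T\<close> maps
  \<open>V\<close> into itself.\<close>

lemma isospectral_on_transfer:
  fixes F :: "'a::real_vector \<Rightarrow> 'b::real_vector"
  assumes F: "linear F" and V: "subspace V" and U: "subspace U" "V \<subseteq> U"
    and inj: "inj_on F U" and onto: "F ` V = W"
    and intertwine: "\<And>f. f \<in> V \<Longrightarrow> S (F f) = F (T f)"
    and T: "\<And>f. f \<in> V \<Longrightarrow> T f \<in> U"
  shows "isospectral_on V T W S"
proof -
  have eig: "S (F f) = l *\<^sub>R F f \<longleftrightarrow> T f = l *\<^sub>R f" if "f \<in> V" for f l
  proof -
    have "S (F f) = l *\<^sub>R F f \<longleftrightarrow> F (T f) = F (l *\<^sub>R f)"
      using that by (simp add: intertwine linear_scale[OF F])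
    also have "\<dots> \<longleftrightarrow> T f = l *\<^sub>R f"
      using inj_on_eq_iff[OF inj T[OF that] subspace_scale[OF U(1), of f]] U(2) that by auto
    finally show ?thesis .
  qed
  have zero: "F f = 0 \<longleftrightarrow> f = 0" if "f \<in> V" for f
    using inj_on_eq_iff[OF inj, of f 0] U that subspace_0[OF U(1)] linear_0[OF F] by auto
  have "F ` eigenspace_on V T l = eigenspace_on W S l" for l
    using eig onto unfolding eigenspace_on_def by blast
  moreover have "dim (F ` eigenspace_on V T l) = dim (eigenspace_on V T l)" for l
  proof (rule dim_linear_image[OF F])
    have "span (eigenspace_on V T l) \<subseteq> V"
      using V by (simp add: span_minimal eigenspace_on_def)
    then have "span (eigenspace_on V T l) \<subseteq> U"
      using U(2) by simp
    then show "inj_on F (span (eigenspace_on V T l))"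
      using inj by (rule inj_on_subset[rotated])
  qed
  ultimately show ?thesis
    unfolding isospectral_on_def onto[symmetric] by (simp add: eig zero cong: bex_cong)
qed

section \<open>Multilinear and homogeneous forms\<close>

text \<open>Multilinearity for all lengths at once.  A form of degree \<open>p\<close> vanishes on lists of other
  lengths, where linearity is trivial, so the degree need not be mentioned.\<close>

definition multilinear :: "('n::real_vector list \<Rightarrow> real) \<Rightarrow> bool" where
  "multilinear \<alpha> \<longleftrightarrow> (\<forall>vs i. i < length vs \<longrightarrow> linear (\<lambda>v. \<alpha> (vs[i := v])))"

lemma multilinear_update: "multilinear \<alpha> \<Longrightarrow> i < length vs \<Longrightarrow> linear (\<lambda>v. \<alpha> (vs[i := v]))"
  by (simp add: multilinear_def)

lemma multilinear_head: "multilinear \<alpha> \<Longrightarrow> linear (\<lambda>v. \<alpha> (v # vs))"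
  using multilinear_update[of \<alpha> 0 "undefined # vs"] by simp

lemma multilinear_Cons: "multilinear \<alpha> \<Longrightarrow> multilinear (\<lambda>vs. \<alpha> (a # vs))"
  unfolding multilinear_def
  using multilinear_update[of \<alpha> "Suc i" "a # vs" for i vs] by (simp add: multilinear_def)

lemma multilinear_diff:
  assumes "multilinear \<alpha>" and "i < length vs"
  shows "\<alpha> (vs[i := a]) - \<alpha> (vs[i := b]) = \<alpha> (vs[i := a - b])"
  using linear_diff[OF multilinear_update[OF assms]] by simp

lemma multilinear_bilinear: "multilinear \<alpha> \<Longrightarrow> bilinear (\<lambda>u v. \<alpha> (u # v # vs))"
  unfolding bilinear_def by (auto intro: multilinear_head[OF multilinear_Cons] multilinear_head)

lemma dir_deriv_eq: "(f has_derivative f') (at x) \<Longrightarrow> dir_deriv f x = f'"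
  by (rule frechet_derivative_at[symmetric])

text \<open>The Leibniz rule for a multilinear function of moving arguments.  Expanding the first
  argument in the fixed basis reduces it to the product rule and a shorter list.\<close>

lemma has_derivative_multilinear:
  fixes E :: "'m::real_normed_vector \<Rightarrow> 'k \<Rightarrow> 'n::euclidean_space"
  assumes "multilinear \<alpha>"
    and "\<And>v. ((\<lambda>y. E y v) has_derivative D v) (at x)"
  shows "((\<lambda>y. \<alpha> (map (E y) vs)) has_derivative
           (\<lambda>u. \<Sum>i<length vs. \<alpha> ((map (E x) vs)[i := D (vs ! i) u]))) (at x)"
  using assms(1)
proof (induction vs arbitrary: \<alpha>)
  case Nil
  then show ?case by simp
next
  case (Cons a vs)
  let ?F = "\<lambda>u. \<Sum>b\<in>Basis. (E x a \<bullet> b) * (\<Sum>i<length vs. \<alpha> (b # (map (E x) vs)[i := D (vs ! i) u]))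
                        + (D a u \<bullet> b) * \<alpha> (b # map (E x) vs)"
  have lin: "linear (\<lambda>v. \<alpha> (v # ws))" for ws
    using Cons.prems by (rule multilinear_head)
  have 1: "((\<lambda>y. \<Sum>b\<in>Basis. (E y a \<bullet> b) * \<alpha> (b # map (E y) vs)) has_derivative ?F) (at x)"
    by (intro has_derivative_sum has_derivative_mult has_derivative_inner_left assms(2)
        Cons.IH[OF multilinear_Cons[OF Cons.prems]])
  have 2: "?F = (\<lambda>u. \<Sum>i<length (a # vs). \<alpha> ((map (E x) (a # vs))[i := D ((a # vs) ! i) u]))"
  proof
    fix u
    have "?F u = (\<Sum>i<length vs. \<Sum>b\<in>Basis. (E x a \<bullet> b) *\<^sub>R \<alpha> (b # (map (E x) vs)[i := D (vs ! i) u]))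
               + (\<Sum>b\<in>Basis. (D a u \<bullet> b) *\<^sub>R \<alpha> (b # map (E x) vs))"
      by (simp add: sum.distrib sum_distrib_left sum.swap[of _ Basis])
    also have "\<dots> = (\<Sum>i<length vs. \<alpha> (E x a # (map (E x) vs)[i := D (vs ! i) u]))
               + \<alpha> (D a u # map (E x) vs)"
      by (simp only: linear_euclidean_expansion[OF lin, symmetric])
    finally show "?F u = (\<Sum>i<length (a # vs). \<alpha> ((map (E x) (a # vs))[i := D ((a # vs) ! i) u]))"
      by (simp add: sum.lessThan_Suc_shift del: sum.lessThan_Suc)
  qed
  have 3: "(\<lambda>y. \<alpha> (map (E y) (a # vs))) = (\<lambda>y. \<Sum>b\<in>Basis. (E y a \<bullet> b) * \<alpha> (b # map (E y) vs))"
    by (rule ext, subst list.map(2), subst linear_euclidean_expansion[OF lin], simp)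
  show ?case
    using 1 unfolding 2 3 .
qed

text \<open>Multilinear forms of degree \<open>p\<close>.  The derivative and codifferential are computed for
  these, with antisymmetry supplied separately where the formula uses it.\<close>

definition homogeneous_form :: "nat \<Rightarrow> ('n::real_vector list \<Rightarrow> real) \<Rightarrow> bool" where
  "homogeneous_form p \<alpha> \<longleftrightarrow> multilinear \<alpha> \<and> (\<forall>vs. length vs \<noteq> p \<longrightarrow> \<alpha> vs = 0)"

lemma homogeneous_formI:
  assumes "\<And>vs. length vs \<noteq> p \<Longrightarrow> \<alpha> vs = 0"
    and "\<And>vs i. length vs = p \<Longrightarrow> i < p \<Longrightarrow> linear (\<lambda>v. \<alpha> (vs[i := v]))"
  shows "homogeneous_form p \<alpha>"
  unfolding homogeneous_form_def multilinear_def
proof (intro conjI allI impI)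
  fix vs :: "'a list" and i
  assume "i < length vs"
  then show "linear (\<lambda>v. \<alpha> (vs[i := v]))"
    using assms by (cases "length vs = p") (simp_all add: linear_zero)
qed (use assms in simp)

lemma homogeneous_form_zero: "homogeneous_form p \<alpha> \<Longrightarrow> length vs \<noteq> p \<Longrightarrow> \<alpha> vs = 0"
  by (simp add: homogeneous_form_def)

lemma homogeneous_form_multilinear: "homogeneous_form p \<alpha> \<Longrightarrow> multilinear \<alpha>"
  by (simp add: homogeneous_form_def)

lemma alternating_homogeneous_form: "\<alpha> \<in> alternating_forms p \<Longrightarrow> homogeneous_form p \<alpha>"
  by (rule homogeneous_formI) (simp_all add: alternating_forms_def)

lemma homogeneous_form_1_linear: "homogeneous_form 1 \<alpha> \<Longrightarrow> linear (\<lambda>u. \<alpha> [u])"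
  by (rule multilinear_head[OF homogeneous_form_multilinear])

lemma alternating_2_antisym: "\<alpha> \<in> alternating_forms 2 \<Longrightarrow> \<alpha> [y, x] = - \<alpha> [x, y]"
  by (rule bilinear_alternating_antisym[where B = "\<lambda>x y. \<alpha> [x, y]"])
    (simp_all add: multilinear_bilinear homogeneous_form_multilinear[OF alternating_homogeneous_form],
     simp add: alternating_forms_def)

lemma length_1_conv: "length vs = 1 \<longleftrightarrow> (\<exists>a. vs = [a])"
  by (simp add: length_Suc_conv)

lemma length_2_conv: "length vs = 2 \<longleftrightarrow> (\<exists>a b. vs = [a, b])"
  by (simp add: numeral_2_eq_2 length_Suc_conv) blast

lemma length_3_conv: "length vs = 3 \<longleftrightarrow> (\<exists>a b c. vs = [a, b, c])"
  by (simp add: numeral_3_eq_3 length_Suc_conv) blast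

lemma subspace_alternating_forms: "subspace (alternating_forms k)"
  unfolding subspace_def alternating_forms_def
  by (auto simp: scaleR_fun_def linear_zero linear_compose_add linear_real_scale)

section \<open>Invariant forms in the left-invariant frame\<close>

text \<open>The differential at \<open>x\<close> of the left translation by \<open>x\<^sup>-\<^sup>1\<close>, that is, the left Maurer-Cartan
  form.  Its inverse, \<open>left_field\<close>, takes \<open>u\<close> to the value at \<open>x\<close> of the left-invariant vector field
  through \<open>u\<close>.\<close>

definition maurer_cartan ::
  "('z::euclidean_space \<Rightarrow> 'v::euclidean_space \<Rightarrow> 'v) \<Rightarrow> 'v \<times> 'z \<Rightarrow> 'v \<times> 'z \<Rightarrow> 'v \<times> 'z" where
  "maurer_cartan J x u = u - (1 / 2) *\<^sub>R lie_bracket J x u"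

definition left_field ::
  "('z::euclidean_space \<Rightarrow> 'v::euclidean_space \<Rightarrow> 'v) \<Rightarrow> 'v \<times> 'z \<Rightarrow> 'v \<times> 'z \<Rightarrow> 'v \<times> 'z" where
  "left_field J x u = u + (1 / 2) *\<^sub>R lie_bracket J x u"

definition invariant_extension ::
  "('z::euclidean_space \<Rightarrow> 'v::euclidean_space \<Rightarrow> 'v) \<Rightarrow> (('v \<times> 'z) list \<Rightarrow> real) \<Rightarrow>
   'v \<times> 'z \<Rightarrow> ('v \<times> 'z) list \<Rightarrow> real" where
  "invariant_extension J \<alpha> x vs = \<alpha> (map (maurer_cartan J x) vs)"

text \<open>The Levi-Civita connection \<open>\<nabla>\<^sub>a b\<close> on left-invariant vector fields, in the form that the
  Koszul formula takes on a 2-step algebra.\<close>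

definition levi_civita ::
  "('z::euclidean_space \<Rightarrow> 'v::euclidean_space \<Rightarrow> 'v) \<Rightarrow> 'v \<times> 'z \<Rightarrow> 'v \<times> 'z \<Rightarrow> 'v \<times> 'z" where
  "levi_civita J a b =
     (1 / 2) *\<^sub>R (lie_bracket J a b - (J (snd a) (fst b) + J (snd b) (fst a), 0))"

text \<open>The exterior derivative of an invariant form, read off at the origin.  It comes from the
  definition by constant vector fields: \<open>- (1/2) [u, v]\<close> is the derivative in the direction \<open>u\<close> of the
  Maurer-Cartan form evaluated on \<open>v\<close>.  On alternating forms each bracket occurs twice, which gives
  the usual Chevalley-Eilenberg differential.\<close>

definition lie_d ::
  "('z::euclidean_space \<Rightarrow> 'v::euclidean_space \<Rightarrow> 'v) \<Rightarrow> (('v \<times> 'z) list \<Rightarrow> real) \<Rightarrow>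
   ('v \<times> 'z) list \<Rightarrow> real" where
  "lie_d J \<alpha> vs =
     (\<Sum>i<length vs. (-1) ^ i * (let ws = take i vs @ drop (Suc i) vs in
        \<Sum>j<length ws. \<alpha> (ws[j := - (1 / 2) *\<^sub>R lie_bracket J (vs ! i) (ws ! j)])))"

text \<open>The codifferential \<open>- \<Sum>\<^sub>b (\<nabla>\<^sub>b \<alpha>)(b, \<dots>)\<close> of an invariant form at the origin.  The term in which
  \<open>\<nabla>\<^sub>b\<close> hits the first argument is absent since \<open>\<nabla>\<^sub>b b = 0\<close> for basis vectors of \<open>\<vv>\<close> or of \<open>\<zz>\<close>.\<close>

definition lie_delta ::
  "('z::euclidean_space \<Rightarrow> 'v::euclidean_space \<Rightarrow> 'v) \<Rightarrow> (('v \<times> 'z) list \<Rightarrow> real) \<Rightarrow>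
   ('v \<times> 'z) list \<Rightarrow> real" where
  "lie_delta J \<alpha> vs =
     (\<Sum>b\<in>Basis. \<Sum>j<length vs. \<alpha> (b # vs[j := levi_civita J b (vs ! j)]))"

locale skew_pencil =
  fixes J :: "'z::euclidean_space \<Rightarrow> 'v::euclidean_space \<Rightarrow> 'v"
  assumes linear_index: "\<And>X. linear (\<lambda>Z. J Z X)"
    and linear_endo: "\<And>Z. linear (J Z)"
    and skew: "\<And>Z X Y. J Z X \<bullet> Y = - (X \<bullet> J Z Y)"
begin

abbreviation bracket where "bracket \<equiv> lie_bracket J"

lemma bracket_inner: "bracket x y \<bullet> c = J (snd c) (fst x) \<bullet> fst y"
  using lie_bracket_inner[of J "snd c" "fst x" "fst y" "snd x" "snd y", OF linear_index]
  by (simp add: lie_bracket_def inner_prod_def)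

lemma fst_bracket [simp]: "fst (bracket x y) = 0"
  by (simp add: lie_bracket_def)

lemma J_zero [simp]: "J 0 X = 0" "J Z 0 = 0"
  using linear_0[OF linear_index] linear_0[OF linear_endo] by auto

lemma bilinear_bracket: "bilinear bracket"
  unfolding bilinear_def
  by (auto simp: lie_bracket_def linear_iff linear_add[OF linear_endo] linear_scale[OF linear_endo]
      inner_add_left inner_add_right scaleR_add_left sum.distrib scaleR_sum_right)

lemmas linear_bracket_left = bilinear_bracket[unfolded bilinear_def, THEN conjunct2, rule_format]
lemmas linear_bracket_right = bilinear_bracket[unfolded bilinear_def, THEN conjunct1, rule_format]

lemma bracket_central [simp]: "fst x = 0 \<Longrightarrow> bracket x y = 0" "fst y = 0 \<Longrightarrow> bracket x y = 0"
  by (simp_all add: lie_bracket_def zero_prod_def)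

lemma bracket_antisym: "bracket y x = - bracket x y"
proof -
  have "bracket y x \<bullet> c = (- bracket x y) \<bullet> c" for c
    using skew[of "snd c" "fst y" "fst x"] by (simp add: bracket_inner inner_commute[of "fst x"] inner_commute[of "fst y"])
  then show ?thesis
    by (rule vector_eq_rdot[THEN iffD1, OF allI])
qed

lemma bracket_self [simp]: "bracket x x = 0"
  using bracket_antisym[of x x] by (simp add: eq_neg_iff_add_eq_0 scaleR_2[symmetric])

lemma linear_maurer_cartan: "linear (maurer_cartan J x)"
  unfolding maurer_cartan_def
  by (intro linear_compose_sub linear_compose_scale_right linear_bracket_right linear_id[unfolded id_def])

lemma fst_maurer_cartan [simp]: "fst (maurer_cartan J x u) = fst u"
  by (simp add: maurer_cartan_def)

lemma bracket_fst_cong: "fst x = fst x' \<Longrightarrow> fst y = fst y' \<Longrightarrow> bracket x y = bracket x' y'"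
  by (simp add: lie_bracket_def)

lemma maurer_cartan_left_field [simp]: "maurer_cartan J x (left_field J x u) = u"
  using bracket_fst_cong[of x x "left_field J x u" u]
  by (simp add: maurer_cartan_def) (simp add: left_field_def)

lemma left_field_maurer_cartan [simp]: "left_field J x (maurer_cartan J x u) = u"
  using bracket_fst_cong[of x x "maurer_cartan J x u" u]
  by (simp add: left_field_def) (simp add: maurer_cartan_def)

lemma bracket_maurer_cartan [simp]:
  "bracket (maurer_cartan J x u) v = bracket u v" "bracket u (maurer_cartan J x v) = bracket u v"
  by (rule bracket_fst_cong; simp)+

lemma maurer_cartan_0 [simp]: "maurer_cartan J 0 = id"
  by (simp add: fun_eq_iff maurer_cartan_def)

lemma linear_left_field: "linear (left_field J x)"
  unfolding left_field_def
  by (intro linear_compose_add linear_compose_scale_right linear_bracket_right linear_id[unfolded id_def])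

lemma dir_deriv_group_mult: "dir_deriv (group_mult J a) x = (\<lambda>u. u + (1 / 2) *\<^sub>R bracket a u)"
proof (rule dir_deriv_eq)
  have "(bracket a has_derivative bracket a) (at x)"
    by (intro bounded_linear_imp_has_derivative linear_conv_bounded_linear[THEN iffD1] linear_bracket_right)
  then show "(group_mult J a has_derivative (\<lambda>u. u + (1 / 2) *\<^sub>R bracket a u)) (at x)"
    unfolding group_mult_def[abs_def] by (auto intro!: derivative_eq_intros)
qed

lemma dir_deriv_translation_to_origin: "dir_deriv (group_mult J (- x)) x = maurer_cartan J x"
  using linear_neg[OF linear_bracket_left]
  by (simp add: dir_deriv_group_mult maurer_cartan_def fun_eq_iff)

lemma left_invariant_metric_eq:
  "left_invariant_metric J x u v = maurer_cartan J x u \<bullet> maurer_cartan J x v"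
  by (simp add: left_invariant_metric_def dir_deriv_translation_to_origin)

lemma has_derivative_maurer_cartan:
  "((\<lambda>y. maurer_cartan J y v) has_derivative (\<lambda>u. - (1 / 2) *\<^sub>R bracket u v)) (at x)"
proof -
  have "((\<lambda>y. bracket y v) has_derivative (\<lambda>u. bracket u v)) (at x)"
    by (intro bounded_linear_imp_has_derivative linear_conv_bounded_linear[THEN iffD1] linear_bracket_left)
  then show ?thesis
    unfolding maurer_cartan_def by (auto intro!: derivative_eq_intros)
qed

text \<open>The Maurer-Cartan form is invertible, so the metric is nondegenerate and covectors have
  unique duals.\<close>

lemma sharp_eqI:
  assumes "\<And>y. maurer_cartan J x w \<bullet> maurer_cartan J x y = \<phi> y"
  shows "sharp (left_invariant_metric J) x \<phi> = w"
  unfolding sharp_def left_invariant_metric_eq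
proof (rule the_equality)
  fix w' assume "\<forall>y. maurer_cartan J x w' \<bullet> maurer_cartan J x y = \<phi> y"
  then have "maurer_cartan J x w' \<bullet> c = maurer_cartan J x w \<bullet> c" for c
    using assms by (metis maurer_cartan_left_field)
  then have "maurer_cartan J x w' = maurer_cartan J x w"
    by (rule vector_eq_rdot[THEN iffD1, OF allI])
  then show "w' = w"
    by (metis left_field_maurer_cartan)
qed (use assms in simp)

lemma levi_civita_inner:
  "levi_civita J a b \<bullet> c = (bracket a b \<bullet> c - bracket a c \<bullet> b - bracket b c \<bullet> a) / 2"
  by (cases a, cases b, cases c)
    (simp add: levi_civita_def bracket_inner inner_diff_left inner_add_left)

lemma dir_deriv_metric:
  "dir_deriv (\<lambda>y. left_invariant_metric J y v w) x u =
     - (bracket u v \<bullet> maurer_cartan J x w + maurer_cartan J x v \<bullet> bracket u w) / 2"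
  unfolding left_invariant_metric_eq
  by (subst dir_deriv_eq[OF has_derivative_inner[OF has_derivative_maurer_cartan has_derivative_maurer_cartan]])
    (simp add: field_simps)

text \<open>The connection in the two frames.  The correction \<open>- (1/2) [u, v]\<close> is there because the
  Christoffel symbol differentiates constant vector fields, not left-invariant ones.\<close>

lemma maurer_cartan_christoffel:
  "maurer_cartan J x (christoffel (left_invariant_metric J) x u v) =
     levi_civita J (maurer_cartan J x u) (maurer_cartan J x v) - (1 / 2) *\<^sub>R bracket u v"
proof -
  have "christoffel (left_invariant_metric J) x u v = left_field J x
      (levi_civita J (maurer_cartan J x u) (maurer_cartan J x v) - (1 / 2) *\<^sub>R bracket u v)"
    unfolding christoffel_def
  proof (rule sharp_eqI)
    fix y
    have anti: "bracket v u = - bracket u v" "bracket y u = - bracket u y" "bracket y v = - bracket v y"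
      by (rule bracket_antisym)+
    show "maurer_cartan J x (left_field J x (levi_civita J (maurer_cartan J x u) (maurer_cartan J x v)
            - (1 / 2) *\<^sub>R bracket u v)) \<bullet> maurer_cartan J x y =
        (dir_deriv (\<lambda>z. left_invariant_metric J z v y) x u + dir_deriv (\<lambda>z. left_invariant_metric J z u y) x v
          - dir_deriv (\<lambda>z. left_invariant_metric J z u v) x y) / 2"
      by (simp add: dir_deriv_metric levi_civita_inner inner_diff_left anti
          inner_commute[of "maurer_cartan J x _" "bracket _ _"] field_simps)
  qed
  then show ?thesis
    by simp
qed

lemma has_derivative_invariant_extension:
  assumes "multilinear \<alpha>"
  shows "((\<lambda>y. invariant_extension J \<alpha> y vs) has_derivative
     (\<lambda>u. \<Sum>i<length vs. \<alpha> ((map (maurer_cartan J x) vs)[i := - (1 / 2) *\<^sub>R bracket u (vs ! i)]))) (at x)"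
  unfolding invariant_extension_def
  by (rule has_derivative_multilinear[OF assms has_derivative_maurer_cartan])

text \<open>The derivative of the Maurer-Cartan form cancels the correction in
  \<open>maurer_cartan_christoffel\<close>, so what remains depends on the arguments only through the frame.\<close>

lemma cov_deriv_invariant_extension:
  assumes "multilinear \<alpha>"
  shows "cov_deriv (left_invariant_metric J) u (invariant_extension J \<alpha>) x vs =
     - (\<Sum>i<length vs. \<alpha> ((map (maurer_cartan J x) vs)
          [i := levi_civita J (maurer_cartan J x u) (maurer_cartan J x (vs ! i))]))"
proof -
  have "\<alpha> (ws[i := - (1 / 2) *\<^sub>R bracket u v]) -
      \<alpha> (ws[i := maurer_cartan J x (christoffel (left_invariant_metric J) x u v)]) =
      - \<alpha> (ws[i := levi_civita J (maurer_cartan J x u) (maurer_cartan J x v)])"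
    if "i < length ws" for ws i v
    using linear_neg[OF multilinear_update[OF assms that],
        of "levi_civita J (maurer_cartan J x u) (maurer_cartan J x v)"]
    unfolding multilinear_diff[OF assms that] maurer_cartan_christoffel by simp
  then show ?thesis
    by (simp add: cov_deriv_def dir_deriv_eq[OF has_derivative_invariant_extension[OF assms]]
        invariant_extension_def[of J \<alpha> x] map_update sum_subtractf[symmetric] sum_negf[symmetric])
qed

lemma linear_levi_civita: "linear (\<lambda>a. levi_civita J a b)" "linear (levi_civita J a)"
  by (auto simp: linear_iff levi_civita_def linear_add[OF linear_endo] linear_scale[OF linear_endo]
     linear_add[OF linear_index] linear_scale[OF linear_index] linear_add[OF linear_bracket_left]
     linear_scale[OF linear_bracket_left] linear_add[OF linear_bracket_right]
     linear_scale[OF linear_bracket_right] prod_eq_iff algebra_simps)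

lemma levi_civita_Basis: "b \<in> Basis \<Longrightarrow> levi_civita J b b = 0"
  by (auto simp: levi_civita_def Basis_prod_def prod_eq_iff)

text \<open>The defining trace runs over the coordinate basis and its metric dual, but a trace
  can be computed in any frame, here in the left-invariant one.\<close>

lemma codifferential_invariant_extension:
  assumes "multilinear \<alpha>"
  shows "codifferential (left_invariant_metric J) (invariant_extension J \<alpha>) =
     invariant_extension J (lie_delta J \<alpha>)"
proof (intro ext)
  fix x vs
  let ?E = "maurer_cartan J x"
  let ?F = "left_field J x"
  let ?ws = "map ?E vs"
  \<comment> \<open>The adjoint of \<open>?F\<close>, since \<open>?F (F' b)\<close> is the metric dual of the covector \<open>b\<close>.\<close>
  define F' where "F' b = (\<Sum>c\<in>Basis. (b \<bullet> ?F c) *\<^sub>R c)" for b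
  have F'_adj: "F' b \<bullet> y = b \<bullet> ?F y" for b y
    using linear_euclidean_expansion[OF linear_left_field, of x y]
    by (simp add: F'_def inner_sum_left inner_sum_right inner_commute mult.commute)
  have sharp: "sharp (left_invariant_metric J) x (\<lambda>y. b \<bullet> y) = ?F (F' b)" for b
    by (rule sharp_eqI) (simp add: F'_adj)
  have trace: "(\<Sum>b\<in>Basis. T (F' b) (?E b)) = (\<Sum>b\<in>Basis. T b b)"
    if "bilinear T" for T :: "'v \<times> 'z \<Rightarrow> 'v \<times> 'z \<Rightarrow> real"
  proof -
    have "bilinear (\<lambda>p q. T p (?E q))"
      using that linear_compose[OF linear_maurer_cartan, of "T p" for p]
      by (simp add: bilinear_def o_def del: split_paired_All)
    from trace_adjoint[OF this F'_adj] show ?thesis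
      by simp
  qed
  have 0: "bilinear (\<lambda>p q. \<alpha> (levi_civita J q p # ?ws))"
    using linear_compose[OF linear_levi_civita(1) multilinear_head[OF assms]]
      linear_compose[OF linear_levi_civita(2) multilinear_head[OF assms]]
    by (simp add: bilinear_def o_def)
  have Suc: "bilinear (\<lambda>p q. \<alpha> (p # ?ws[j := levi_civita J q (?ws ! j)]))" if "j < length ?ws" for j
    using linear_compose[OF linear_levi_civita(1) multilinear_update[OF multilinear_Cons[OF assms] that]]
      multilinear_head[OF assms]
    by (simp add: bilinear_def o_def)
  have "codifferential (left_invariant_metric J) (invariant_extension J \<alpha>) x vs =
      (\<Sum>b\<in>Basis. \<alpha> (levi_civita J (?E b) (F' b) # ?ws) +
        (\<Sum>j<length vs. \<alpha> (F' b # ?ws[j := levi_civita J (?E b) (?ws ! j)])))"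
    unfolding codifferential_def cov_deriv_invariant_extension[OF assms] sharp
    by (subst sum_negf[symmetric]) (simp add: sum_negf sum.lessThan_Suc_shift add.commute del: sum.lessThan_Suc)
  also have "\<dots> = (\<Sum>b\<in>Basis. \<alpha> (levi_civita J (?E b) (F' b) # ?ws)) +
        (\<Sum>j<length vs. \<Sum>b\<in>Basis. \<alpha> (F' b # ?ws[j := levi_civita J (?E b) (?ws ! j)]))"
    by (simp add: sum.distrib sum.swap[of _ Basis])
  also have "(\<Sum>b\<in>Basis. \<alpha> (levi_civita J (?E b) (F' b) # ?ws)) = 0"
    unfolding trace[OF 0] by (simp add: levi_civita_Basis linear_0[OF multilinear_head[OF assms]])
  also have "(\<Sum>j<length vs. \<Sum>b\<in>Basis. \<alpha> (F' b # ?ws[j := levi_civita J (?E b) (?ws ! j)])) =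
      (\<Sum>j<length vs. \<Sum>b\<in>Basis. \<alpha> (b # ?ws[j := levi_civita J b (?ws ! j)]))"
    by (rule sum.cong) (use trace[OF Suc] in auto)
  finally show "codifferential (left_invariant_metric J) (invariant_extension J \<alpha>) x vs =
      invariant_extension J (lie_delta J \<alpha>) x vs"
    by (simp add: invariant_extension_def[of J "lie_delta J \<alpha>"] lie_delta_def sum.swap[of _ Basis])
qed

lemma ext_deriv_invariant_extension:
  assumes "multilinear \<alpha>"
  shows "ext_deriv (invariant_extension J \<alpha>) = invariant_extension J (lie_d J \<alpha>)"
  by (intro ext)
    (auto simp: ext_deriv_def invariant_extension_def[of J "lie_d J \<alpha>"] lie_d_def Let_def
      dir_deriv_eq[OF has_derivative_invariant_extension[OF assms]] take_map drop_map
      nth_append intro!: sum.cong arg_cong[of _ _ \<alpha>] arg_cong2[of _ _ _ _ list_update])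

definition lie_laplacian :: "(('v \<times> 'z) list \<Rightarrow> real) \<Rightarrow> ('v \<times> 'z) list \<Rightarrow> real" where
  "lie_laplacian \<alpha> vs = - (lie_d J (lie_delta J \<alpha>) vs + lie_delta J (lie_d J \<alpha>) vs)"

lemma laplacian_invariant_extension:
  assumes "multilinear \<alpha>" "multilinear (lie_delta J \<alpha>)" "multilinear (lie_d J \<alpha>)"
  shows "laplacian (left_invariant_metric J) (invariant_extension J \<alpha>) =
     invariant_extension J (lie_laplacian \<alpha>)"
  by (simp add: laplacian_def codifferential_invariant_extension ext_deriv_invariant_extension assms
      fun_eq_iff invariant_extension_def lie_laplacian_def)

text \<open>Invariance under the translation by \<open>x\<^sup>-\<^sup>1\<close> recovers the form at \<open>x\<close> from its value at the origin.
  Conversely, the Maurer-Cartan form is itself invariant under left translations.\<close>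

lemma left_invariant_forms_eq:
  "left_invariant_forms J p = invariant_extension J ` alternating_forms p"
proof (intro set_eqI iffI)
  fix \<omega> assume \<omega>: "\<omega> \<in> left_invariant_forms J p"
  have "pullback (group_mult J (- x)) \<omega> x vs = \<omega> x vs" for x vs
    using \<omega> unfolding left_invariant_forms_def by (simp del: split_paired_All)
  then have "\<omega> x vs = invariant_extension J (\<omega> 0) x vs" for x vs
    using linear_neg[OF linear_bracket_left, of x x for x]
    by (simp add: pullback_def dir_deriv_translation_to_origin invariant_extension_def group_mult_def
        zero_prod_def[symmetric])
  then have "\<omega> = invariant_extension J (\<omega> 0)"
    by blast
  moreover have "\<omega> 0 \<in> alternating_forms p"
    using \<omega> by (simp add: left_invariant_forms_def del: split_paired_All)
  ultimately show "\<omega> \<in> invariant_extension J ` alternating_forms p"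
    by blast
next
  fix \<omega> assume "\<omega> \<in> invariant_extension J ` alternating_forms p"
  then obtain \<alpha> where \<alpha>: "\<alpha> \<in> alternating_forms p" and \<omega>: "\<omega> = invariant_extension J \<alpha>"
    by blast
  \<comment> \<open>Central parts drop out of brackets, so \<open>[a x, u] = [a, u] + [x, u]\<close>, and the first summand is what
    the differential of the translation has added.\<close>
  have "maurer_cartan J (group_mult J a x) (u + (1 / 2) *\<^sub>R bracket a u) = maurer_cartan J x u" for a x u
  proof -
    have "bracket (group_mult J a x) (u + (1 / 2) *\<^sub>R bracket a u) = bracket (a + x) u"
      by (rule bracket_fst_cong) (simp_all add: group_mult_def)
    then show ?thesis
      by (simp add: maurer_cartan_def linear_add[OF linear_bracket_left] scaleR_add_right)
  qed
  then have "pullback (group_mult J a) \<omega> = \<omega>" for a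
    by (intro ext) (simp add: \<omega> pullback_def invariant_extension_def dir_deriv_group_mult o_def)
  moreover have "\<omega> x \<in> alternating_forms p" for x
  proof -
    have "\<not> distinct (map (maurer_cartan J x) vs)" if "\<not> distinct vs" for vs
      using that by (simp add: distinct_map)
    moreover have "linear (\<lambda>v. \<alpha> ((map (maurer_cartan J x) vs)[i := maurer_cartan J x v]))"
      if "length vs = p" "i < p" for vs i
      using \<alpha> that linear_compose[OF linear_maurer_cartan[of x], of "\<lambda>v. \<alpha> ((map (maurer_cartan J x) vs)[i := v])"]
      by (simp add: alternating_forms_def o_def)
    ultimately show ?thesis
      using \<alpha> by (simp add: alternating_forms_def \<omega> invariant_extension_def map_update)
  qed
  ultimately show "\<omega> \<in> left_invariant_forms J p"
    by (simp add: left_invariant_forms_def)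
qed

lemma invariant_extension_0 [simp]: "invariant_extension J \<alpha> 0 = \<alpha>"
  by (simp add: fun_eq_iff invariant_extension_def)

lemma invariant_extension_eq_iff: "invariant_extension J \<alpha> = invariant_extension J \<beta> \<longleftrightarrow> \<alpha> = \<beta>"
  by (metis invariant_extension_0)

lemma linear_invariant_extension: "linear (invariant_extension J)"
  by (simp add: linear_iff invariant_extension_def fun_eq_iff scaleR_fun_def)

end

section \<open>The Laplacian on forms of degree one and two\<close>

context skew_pencil
begin

lemma linear_endo_left: "linear (\<lambda>Y. (J Z Y, 0))"
  using linear_compose[OF linear_endo linear_left_summand] by (simp add: o_def)

lemma linear_bracket_left_summand: "linear (\<lambda>X. bracket (X, 0) v)"
  using linear_compose[OF linear_left_summand linear_bracket_left] by (simp add: o_def)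

lemma bracket_v_expansion:
  "bracket (X, Z) u = - (\<Sum>f\<in>Basis. (X \<bullet> J f (fst u)) *\<^sub>R (0, f))"
  by (simp add: lie_bracket_def prod_eq_iff skew fst_sum snd_sum sum_negf)

text \<open>The codifferential contracts an alternating form with the connection.  Of the three terms
  of \<open>\<nabla>\<^sub>b u\<close>, the bracket term contributes for \<open>b\<close> in \<open>\<vv>\<close> and \<open>J\<^sub>b u\<close> for \<open>b\<close> in \<open>\<zz>\<close>; both are the same
  sum over \<open>\<vv>\<close> and \<open>\<zz>\<close> and cancel.  Only \<open>J\<^sub>u b\<close> survives.\<close>

lemma trace_levi_civita:
  assumes B: "bilinear B" and anti: "\<And>x y. B y x = - (B x y :: real)"
  shows "(\<Sum>b\<in>Basis. B b (levi_civita J b u)) = - (1 / 2) * (\<Sum>e\<in>Basis. B (e, 0) (J (snd u) e, 0))"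
proof -
  have "(\<Sum>e\<in>Basis. B (e, 0) (bracket (e, 0) u)) =
      - (\<Sum>e\<in>Basis. \<Sum>f\<in>Basis. (e \<bullet> J f (fst u)) * B (e, 0) (0, f))"
    using B by (simp add: bracket_v_expansion bilinear_rneg[OF B] bilinear_rmul[OF B] sum_negf
        linear_sum[of "B (_, 0)"] bilinear_def del: split_paired_All scaleR_Pair)
  also have "\<dots> = - (\<Sum>f\<in>Basis. \<Sum>e\<in>Basis. (J f (fst u) \<bullet> e) *\<^sub>R B (e, 0) (0, f))"
    by (subst sum.swap) (simp add: inner_commute)
  also have "\<dots> = - (\<Sum>f\<in>Basis. B (J f (fst u), 0) (0, f))"
  proof -
    have "linear (\<lambda>X. B (X, 0) (0, f))" for f
      using bilinear_ladd[OF B, of "(_, 0)" "(_, 0)"] bilinear_lmul[OF B, of _ "(_, 0)"]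
      by (simp add: linear_iff)
    then show ?thesis
      by (simp only: linear_euclidean_expansion[where f = "\<lambda>X. B (X, 0) (0, _)", symmetric])
  qed
  finally have cancel: "(\<Sum>e\<in>Basis. B (e, 0) (bracket (e, 0) u)) = (\<Sum>f\<in>Basis. B (0, f) (J f (fst u), 0))"
    by (simp add: anti[of "(0, _)"] sum_negf)
  have "(\<Sum>b\<in>Basis. B b (levi_civita J b u)) = (\<Sum>e\<in>Basis. B (e, 0) (levi_civita J (e, 0) u))
      + (\<Sum>f\<in>Basis. B (0, f) (levi_civita J (0, f) u))"
    by (rule sum_Basis_prod)
  also have "(\<Sum>e\<in>Basis. B (e, 0) (levi_civita J (e, 0) u)) =
      (1 / 2) * ((\<Sum>e\<in>Basis. B (e, 0) (bracket (e, 0) u)) - (\<Sum>e\<in>Basis. B (e, 0) (J (snd u) e, 0)))"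
    by (simp add: levi_civita_def bilinear_rmul[OF B] bilinear_rsub[OF B] sum_subtractf
        sum_divide_distrib[symmetric] del: scaleR_Pair)
  also have "(\<Sum>f\<in>Basis. B (0, f) (levi_civita J (0, f) u)) = - (1 / 2) * (\<Sum>f\<in>Basis. B (0, f) (J f (fst u), 0))"
    by (simp add: levi_civita_def bilinear_rmul[OF B] bilinear_rneg[OF B] sum_negf
        sum_distrib_left del: scaleR_Pair diff_Pair uminus_Pair)
  finally show ?thesis
    by (simp add: cancel algebra_simps)
qed

lemma lie_delta_1:
  assumes "homogeneous_form 1 \<alpha>"
  shows "lie_delta J \<alpha> = 0"
proof
  fix vs
  show "lie_delta J \<alpha> vs = 0 vs"
    by (cases "vs = []") (simp_all add: lie_delta_def homogeneous_form_zero[OF assms])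
qed

lemma lie_delta_2:
  assumes "homogeneous_form 2 \<alpha>" and "\<And>x y. \<alpha> [y, x] = - \<alpha> [x, y]"
  shows "lie_delta J \<alpha> [u] = - (1 / 2) * (\<Sum>e\<in>Basis. \<alpha> [(e, 0), (J (snd u) e, 0)])"
proof -
  have "(\<Sum>b\<in>Basis. \<alpha> [b, levi_civita J b u]) = - (1 / 2) * (\<Sum>e\<in>Basis. \<alpha> [(e, 0), (J (snd u) e, 0)])"
    by (rule trace_levi_civita[of "\<lambda>x y. \<alpha> [x, y]"])
      (rule multilinear_bilinear[OF homogeneous_form_multilinear[OF assms(1)]], rule assms(2))
  then show ?thesis
    by (simp add: lie_delta_def)
qed

lemma homogeneous_form_lie_delta_2:
  assumes "homogeneous_form 2 \<alpha>" and "\<And>x y. \<alpha> [y, x] = - \<alpha> [x, y]"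
  shows "homogeneous_form 1 (lie_delta J \<alpha>)"
proof (rule homogeneous_formI)
  fix vs :: "('v \<times> 'z) list"
  assume "length vs \<noteq> 1"
  then show "lie_delta J \<alpha> vs = 0"
    by (simp add: lie_delta_def homogeneous_form_zero[OF assms(1)])
next
  fix vs :: "('v \<times> 'z) list" and i :: nat
  assume len: "length vs = 1" and "i < 1"
  then have i: "i = 0" by linarith
  obtain a where vs: "vs = [a]"
    using len unfolding length_1_conv by blast
  have "linear (\<lambda>v. \<alpha> [b, levi_civita J b v])" for b
    using linear_compose[OF linear_levi_civita(2) multilinear_head[OF multilinear_Cons]]
      homogeneous_form_multilinear[OF assms(1)] by (simp add: o_def)
  then show "linear (\<lambda>v. lie_delta J \<alpha> (vs[i := v]))"
    using i by (simp add: vs lie_delta_def linear_compose_sum)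
qed

text \<open>By antisymmetry both connection terms of the codifferential are contractions in the first
  two slots, with the third argument held fixed.\<close>

lemma lie_delta_3:
  assumes "homogeneous_form 3 \<gamma>"
    and "\<And>x y w. \<gamma> [y, x, w] = - \<gamma> [x, y, w]" and "\<And>x y w. \<gamma> [x, w, y] = - \<gamma> [x, y, w]"
  shows "lie_delta J \<gamma> [u, v] = - (1 / 2) * ((\<Sum>e\<in>Basis. \<gamma> [(e, 0), (J (snd u) e, 0), v])
      - (\<Sum>e\<in>Basis. \<gamma> [(e, 0), (J (snd v) e, 0), u]))"
proof -
  have *: "(\<Sum>b\<in>Basis. \<gamma> [b, levi_civita J b u, v]) =
      - (1 / 2) * (\<Sum>e\<in>Basis. \<gamma> [(e, 0), (J (snd u) e, 0), v])" for u v
    using multilinear_bilinear[OF homogeneous_form_multilinear[OF assms(1)]] assms(2)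
    by (rule trace_levi_civita[of "\<lambda>x y. \<gamma> [x, y, v]" u])
  have "lie_delta J \<gamma> [u, v] = (\<Sum>b\<in>Basis. \<gamma> [b, levi_civita J b u, v] - \<gamma> [b, levi_civita J b v, u])"
    by (simp add: lie_delta_def assms(3)[of _ "levi_civita J _ v" u])
  then show ?thesis
    by (simp add: sum_subtractf * diff_divide_distrib)
qed

lemma lie_d_1:
  assumes "homogeneous_form 1 \<alpha>"
  shows "lie_d J \<alpha> [u, v] = - \<alpha> [bracket u v]"
  using homogeneous_form_1_linear[OF assms]
  by (simp add: lie_d_def Let_def bracket_antisym[of v u] linear_neg[of "\<lambda>u. \<alpha> [u]"] linear_scale[of "\<lambda>u. \<alpha> [u]"])

lemma lie_d_zero:
  assumes "homogeneous_form p \<alpha>" and "length vs \<noteq> Suc p"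
  shows "lie_d J \<alpha> vs = 0"
proof -
  have "\<alpha> ((take i vs @ drop (Suc i) vs)[j := w]) = 0" if "i < length vs" for i j w
    using assms that by (intro homogeneous_form_zero[OF assms(1)]) simp
  then show ?thesis
    by (simp add: lie_d_def Let_def)
qed

lemma homogeneous_form_lie_d_1:
  assumes "homogeneous_form 1 \<alpha>"
  shows "homogeneous_form 2 (lie_d J \<alpha>)"
proof (rule homogeneous_formI)
  fix vs :: "('v \<times> 'z) list" and i :: nat
  assume len: "length vs = 2" and "i < 2"
  then have i: "i = 0 \<or> i = 1" by linarith
  obtain a b where vs: "vs = [a, b]"
    using len unfolding length_2_conv by blast
  note lin = linear_compose[OF _ homogeneous_form_1_linear[OF assms], unfolded o_def]
  show "linear (\<lambda>v. lie_d J \<alpha> (vs[i := v]))"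
    using vs i by (auto simp: lie_d_1[OF assms] intro!: linear_compose_neg lin linear_bracket_left linear_bracket_right)
qed (simp add: lie_d_zero[OF assms])

lemma lie_d_2:
  assumes "homogeneous_form 2 \<alpha>" and "\<And>x y. \<alpha> [y, x] = - \<alpha> [x, y]"
  shows "lie_d J \<alpha> [u, v, w] = - \<alpha> [bracket u v, w] + \<alpha> [bracket u w, v] - \<alpha> [bracket v w, u]"
proof -
  have lin: "linear (\<lambda>u. \<alpha> [u, v])" for v
    by (rule multilinear_head[OF homogeneous_form_multilinear[OF assms(1)]])
  have left: "\<alpha> [- ((1 / 2) *\<^sub>R a), b] = - \<alpha> [a, b] / 2" "\<alpha> [(1 / 2) *\<^sub>R a, b] = \<alpha> [a, b] / 2" for a b
    using linear_neg[OF lin] linear_scale[OF lin] by auto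
  have right: "\<alpha> [b, - ((1 / 2) *\<^sub>R a)] = \<alpha> [a, b] / 2" "\<alpha> [b, (1 / 2) *\<^sub>R a] = - \<alpha> [a, b] / 2" for a b
    using left assms(2)[of b "- ((1 / 2) *\<^sub>R a)" for a b] assms(2)[of b "(1 / 2) *\<^sub>R a" for a b] by simp_all
  show ?thesis
    by (simp add: lie_d_def Let_def numeral_2_eq_2 left right bracket_antisym[of v u] bracket_antisym[of w u]
        bracket_antisym[of w v])
qed

lemma homogeneous_form_lie_d_2:
  assumes "homogeneous_form 2 \<alpha>" and "\<And>x y. \<alpha> [y, x] = - \<alpha> [x, y]"
  shows "homogeneous_form 3 (lie_d J \<alpha>)"
proof (rule homogeneous_formI)
  fix vs :: "('v \<times> 'z) list" and i :: nat
  assume len: "length vs = 3" and "i < 3"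
  then have i: "i = 0 \<or> i = 1 \<or> i = 2" by linarith
  obtain a b c where vs: "vs = [a, b, c]"
    using len unfolding length_3_conv by blast
  have "bilinear (\<lambda>x y. \<alpha> [x, y])"
    by (rule multilinear_bilinear[OF homogeneous_form_multilinear[OF assms(1)]])
  then have 1: "linear (\<lambda>x. \<alpha> [x, y])" and 2: "linear (\<lambda>x. \<alpha> [y, x])" for y
    unfolding bilinear_def by blast+
  have 3: "linear (\<lambda>x. \<alpha> [bracket x y, z])" "linear (\<lambda>x. \<alpha> [bracket y x, z])" for y z
    using linear_compose[OF linear_bracket_left 1] linear_compose[OF linear_bracket_right 1]
    by (simp_all add: o_def)
  show "linear (\<lambda>v. lie_d J \<alpha> (vs[i := v]))"
    using i by (elim disjE; simp add: vs lie_d_2[OF assms] numeral_2_eq_2;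
        intro linear_compose_neg linear_compose_add linear_compose_sub 2 3)
qed (rule lie_d_zero[OF assms(1)], simp)

lemma lie_laplacian_zero:
  assumes "homogeneous_form p \<alpha>" and "length vs \<noteq> p"
  shows "lie_laplacian \<alpha> vs = 0"
proof -
  have "lie_delta J (lie_d J \<alpha>) vs = 0"
    using assms(2) by (simp add: lie_delta_def lie_d_zero[OF assms(1)])
  moreover have "lie_d J (lie_delta J \<alpha>) vs = 0"
  proof -
    have "lie_delta J \<alpha> ((take i vs @ drop (Suc i) vs)[j := w]) = 0" if "i < length vs" for i j w
      using assms(2) that by (simp add: lie_delta_def homogeneous_form_zero[OF assms(1)])
    then show ?thesis
      by (simp add: lie_d_def Let_def)
  qed
  ultimately show ?thesis
    by (simp add: lie_laplacian_def)
qed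

lemma laplacian_invariant_extension_1:
  assumes "\<alpha> \<in> alternating_forms 1"
  shows "laplacian (left_invariant_metric J) (invariant_extension J \<alpha>) = invariant_extension J (lie_laplacian \<alpha>)"
proof -
  note hom = alternating_homogeneous_form[OF assms]
  have "multilinear (lie_delta J \<alpha>)"
    by (simp add: lie_delta_1[OF hom] multilinear_def linear_zero)
  then show ?thesis
    by (intro laplacian_invariant_extension homogeneous_form_multilinear[OF hom]
        homogeneous_form_multilinear[OF homogeneous_form_lie_d_1[OF hom]])
qed

lemma laplacian_invariant_extension_2:
  assumes "\<alpha> \<in> alternating_forms 2"
  shows "laplacian (left_invariant_metric J) (invariant_extension J \<alpha>) = invariant_extension J (lie_laplacian \<alpha>)"
  using alternating_homogeneous_form[OF assms] alternating_2_antisym[OF assms]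
  by (intro laplacian_invariant_extension homogeneous_form_multilinear[OF homogeneous_form_lie_delta_2]
      homogeneous_form_multilinear[OF homogeneous_form_lie_d_2] homogeneous_form_multilinear[of 2 \<alpha>])

text \<open>The bilinear form on \<open>\<vv>\<close> whose traces make up \<open>\<delta>d\<alpha>\<close>.  Each summand contains \<open>X\<close> and \<open>Y\<close> once,
  which is what makes its trace insensitive to the deformation.\<close>

definition delta_d_form :: "(('v \<times> 'z) list \<Rightarrow> real) \<Rightarrow> 'z \<Rightarrow> 'v \<times> 'z \<Rightarrow> 'v \<Rightarrow> 'v \<Rightarrow> real" where
  "delta_d_form \<alpha> Z v X Y = 2 * \<alpha> [bracket (X, 0) v, (J Z Y, 0)] - \<alpha> [bracket (X, 0) (J Z Y, 0), v]"

lemma bilinear_delta_d_form: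
  assumes "multilinear \<alpha>"
  shows "bilinear (delta_d_form \<alpha> Z v)"
proof -
  note \<alpha> = multilinear_bilinear[OF assms, of "[]"]
  have comp: "linear (\<lambda>x. \<alpha> [f x, v])" if "linear f" for f :: "'v \<Rightarrow> 'v \<times> 'z"
    using linear_compose[OF that multilinear_head[OF assms, of "[v]"]] by (simp add: o_def)
  have 1: "bilinear (\<lambda>X Y. \<alpha> [bracket (X, 0) v, (J Z Y, 0)])"
    by (rule bilinear_compose[OF \<alpha> linear_bracket_left_summand linear_endo_left])
  have "bilinear (\<lambda>X Y. bracket (X, 0) (J Z Y, 0))"
    by (rule bilinear_compose[OF bilinear_bracket linear_left_summand linear_endo_left])
  then have 2: "bilinear (\<lambda>X Y. \<alpha> [bracket (X, 0) (J Z Y, 0), v])"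
    unfolding bilinear_def by (intro conjI allI comp; blast)
  show ?thesis
    using 1 2 unfolding delta_d_form_def[abs_def] bilinear_def
    by (intro conjI allI linear_compose_sub linear_real_scale; blast)
qed

lemma lie_delta_lie_d_2:
  assumes "\<alpha> \<in> alternating_forms 2"
  shows "lie_delta J (lie_d J \<alpha>) [u, v] = - (1 / 2) *
    ((\<Sum>e\<in>Basis. delta_d_form \<alpha> (snd u) v e e) - (\<Sum>e\<in>Basis. delta_d_form \<alpha> (snd v) u e e))"
proof -
  note hom = alternating_homogeneous_form[OF assms]
  note anti = alternating_2_antisym[OF assms]
  note \<alpha> = multilinear_bilinear[OF homogeneous_form_multilinear[OF hom], of "[]"]
  have neg: "\<alpha> [- x, y] = - \<alpha> [x, y]" for x y
    using bilinear_lneg[OF \<alpha>] .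
  have anti1: "lie_d J \<alpha> [y, x, w] = - lie_d J \<alpha> [x, y, w]" for x y w
    by (simp add: lie_d_2[OF hom anti] bracket_antisym[of y x] neg)
  have anti2: "lie_d J \<alpha> [x, w, y] = - lie_d J \<alpha> [x, y, w]" for x y w
    by (simp add: lie_d_2[OF hom anti] bracket_antisym[of w y] neg)
  have "(\<Sum>e\<in>Basis. lie_d J \<alpha> [(e, 0), (J Z e, 0), v]) = (\<Sum>e\<in>Basis. delta_d_form \<alpha> Z v e e)" for Z v
  proof -
    have adj: "J Z X \<bullet> Y = X \<bullet> - J Z Y" for X Y
      by (simp add: skew)
    \<comment> \<open>Skewness of \<open>J Z\<close> turns the third term of \<open>d\<alpha>\<close> into another copy of the second, hence the factor 2.\<close>
    have "(\<Sum>e\<in>Basis. \<alpha> [bracket (J Z e, 0) v, (e, 0)]) = (\<Sum>e\<in>Basis. \<alpha> [bracket (e, 0) v, (- J Z e, 0)])"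
      by (rule trace_adjoint[OF bilinear_compose[OF \<alpha> linear_bracket_left_summand linear_left_summand] adj])
    also have "\<dots> = - (\<Sum>e\<in>Basis. \<alpha> [bracket (e, 0) v, (J Z e, 0)])"
      using bilinear_rneg[OF \<alpha>, of _ "(_, 0)"] by (simp add: sum_negf)
    finally show ?thesis
      by (simp add: lie_d_2[OF hom anti] delta_d_form_def sum.distrib sum_subtractf sum_negf
          sum_distrib_left[symmetric])
  qed
  then show ?thesis
    unfolding lie_delta_3[OF homogeneous_form_lie_d_2[OF hom anti] anti1 anti2] by simp
qed

end

section \<open>The deformation and its intertwining operator\<close>

text \<open>The orthogonal projection onto the \<open>(-1)\<close>-eigenspace of an orthogonal involution.\<close>

definition anti_part :: "('v::real_vector \<Rightarrow> 'v) \<Rightarrow> 'v \<Rightarrow> 'v" where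
  "anti_part \<sigma> X = (1 / 2) *\<^sub>R (X - \<sigma> X)"

definition anti_proj :: "('v::real_vector \<Rightarrow> 'v) \<Rightarrow> 'v \<times> 'z::real_vector \<Rightarrow> 'v \<times> 'z" where
  "anti_proj \<sigma> x = (anti_part \<sigma> (fst x), 0)"

text \<open>For \<open>c = 2\<close> and 2-forms this changes the sign of the component in \<open>\<Lambda>\<^sup>2 \<vv>\<^sub>-\<close>; for \<open>c = 0\<close> it is the
  identity, which serves for 1-forms.  Both values satisfy \<open>c\<^sup>2 = 2 c\<close>, the condition for an
  involution.\<close>

definition flip ::
  "real \<Rightarrow> ('v::real_vector \<Rightarrow> 'v) \<Rightarrow> (('v \<times> 'z::real_vector) list \<Rightarrow> real) \<Rightarrow> ('v \<times> 'z) list \<Rightarrow> real" where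
  "flip c \<sigma> \<alpha> vs = \<alpha> vs - c * \<alpha> (map (anti_proj \<sigma>) vs)"

lemma flip_0 [simp]: "flip 0 \<sigma> \<alpha> = \<alpha>"
  by (simp add: flip_def fun_eq_iff)

lemma linear_flip: "linear (flip c \<sigma>)"
  by (simp add: linear_iff flip_def fun_eq_iff scaleR_fun_def algebra_simps)

locale sigma_deformation = skew_pencil J
  for J :: "'z::euclidean_space \<Rightarrow> 'v::euclidean_space \<Rightarrow> 'v" +
  fixes \<sigma> :: "'v \<Rightarrow> 'v"
  assumes orthogonal: "orthogonal_transformation \<sigma>"
    and involution: "\<sigma> \<circ> \<sigma> = id"
    and commute: "\<And>Z. \<sigma> \<circ> J Z = J Z \<circ> \<sigma>"
begin

lemma sigma_sigma [simp]: "\<sigma> (\<sigma> X) = X"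
  using involution by (simp add: fun_eq_iff)

lemma sigma_J: "\<sigma> (J Z X) = J Z (\<sigma> X)"
  using commute by (simp add: fun_eq_iff)

lemma linear_sigma: "linear \<sigma>"
  using orthogonal by (rule orthogonal_transformation_linear)

lemma sigma_symmetric: "\<sigma> X \<bullet> Y = X \<bullet> \<sigma> Y"
  using orthogonal unfolding orthogonal_transformation_def by (metis sigma_sigma)

abbreviation K where "K \<equiv> deformation \<sigma> J"

lemma K_apply: "K Z X = J Z (\<sigma> X)"
  by (simp add: deformation_def sigma_J)

lemma skew_pencil_deformation: "skew_pencil K"
proof (rule skew_pencil.intro)
  show "linear (\<lambda>Z. K Z X)" for X
    by (simp add: K_apply linear_index)
  show "linear (K Z)" for Z
    using linear_compose[OF linear_sigma linear_endo] by (simp add: K_apply[abs_def] o_def)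
  show "K Z X \<bullet> Y = - (X \<bullet> K Z Y)" for Z X Y
    by (simp add: K_apply skew sigma_symmetric sigma_J)
qed

sublocale deformed: skew_pencil K
  by (rule skew_pencil_deformation)

lemma deformed_bracket: "lie_bracket K (X, a) y = bracket (\<sigma> X, b) y"
  by (simp add: lie_bracket_def K_apply)

lemma bracket_sigma_sigma: "bracket (\<sigma> X, a) (\<sigma> Y, b) = bracket (X, c) (Y, d)"
  by (simp add: lie_bracket_def sigma_symmetric[symmetric] sigma_J)

text \<open>The image of an orthonormal basis under \<open>\<sigma>\<close> is again an orthonormal basis.\<close>

lemma trace_sigma:
  assumes "bilinear T"
  shows "(\<Sum>e\<in>Basis. T (\<sigma> e) (\<sigma> e)) = (\<Sum>e\<in>Basis. T e e)"
proof -
  have "bilinear (\<lambda>x y. T x (\<sigma> y))"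
    using assms linear_compose[OF linear_sigma, of "T x" for x] by (simp add: bilinear_def o_def)
  from trace_adjoint[OF this sigma_symmetric] show ?thesis
    by simp
qed

abbreviation p :: "'v \<Rightarrow> 'v" where "p \<equiv> anti_part \<sigma>"
abbreviation P :: "'v \<times> 'z \<Rightarrow> 'v \<times> 'z" where "P \<equiv> anti_proj \<sigma>"

lemma linear_p: "linear p"
  by (simp add: linear_iff anti_part_def linear_add[OF linear_sigma] linear_scale[OF linear_sigma] algebra_simps)

lemma p_sigma: "p (\<sigma> X) = - p X"
  by (simp add: anti_part_def scaleR_diff_right)

lemma p_p [simp]: "p (p X) = p X"
proof -
  have "p (p X) = (1 / 2) *\<^sub>R (p X - p (\<sigma> X))"
    by (subst (2) anti_part_def) (simp only: linear_scale[OF linear_p] linear_diff[OF linear_p])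
  then show ?thesis
    by (simp add: p_sigma scaleR_2[symmetric])
qed

lemma p_symmetric: "p X \<bullet> Y = X \<bullet> p Y"
  by (simp add: anti_part_def inner_diff_left inner_diff_right sigma_symmetric)

lemma p_J: "p (J Z X) = J Z (p X)"
  by (simp add: anti_part_def linear_scale[OF linear_endo] linear_diff[OF linear_endo] sigma_J)

lemma sigma_eq: "\<sigma> X = X - 2 *\<^sub>R p X"
  by (simp add: anti_part_def)

lemma P_pair [simp]: "P (X, Z) = (p X, 0)"
  by (simp add: anti_proj_def)

lemma fst_P [simp]: "fst (P x) = p (fst x)"
  by (simp add: anti_proj_def)

lemma snd_P [simp]: "snd (P x) = 0"
  by (simp add: anti_proj_def)

lemma P_P [simp]: "P (P x) = P x"
  by (cases x) simp

lemma P_central [simp]: "fst x = 0 \<Longrightarrow> P x = 0"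
  by (simp add: anti_proj_def linear_0[OF linear_p] zero_prod_def)

lemma linear_P: "linear P"
  by (simp add: linear_iff linear_add[OF linear_p] linear_scale[OF linear_p])

lemma flip_involution:
  assumes "c * c = 2 * c"
  shows "flip c \<sigma> (flip c \<sigma> \<alpha>) = (\<alpha> :: ('v \<times> 'z) list \<Rightarrow> real)"
proof
  fix vs
  have "flip c \<sigma> (flip c \<sigma> \<alpha>) vs = \<alpha> vs + (c * c - 2 * c) * \<alpha> (map P vs)"
    by (simp add: flip_def o_def algebra_simps)
  then show "flip c \<sigma> (flip c \<sigma> \<alpha>) vs = \<alpha> vs"
    using assms by simp
qed

lemma flip_alternating:
  assumes "\<alpha> \<in> alternating_forms k"
  shows "flip c \<sigma> \<alpha> \<in> (alternating_forms k :: (('v \<times> 'z) list \<Rightarrow> real) set)"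
proof -
  have "linear (\<lambda>v. flip c \<sigma> \<alpha> (vs[i := v]))" if "length vs = k" "i < k" for vs i
  proof -
    have "linear (\<lambda>v. \<alpha> (vs[i := v]))" "linear (\<lambda>v. \<alpha> ((map P vs)[i := v]))"
      using assms that by (simp_all add: alternating_forms_def)
    then show ?thesis
      using linear_compose[OF linear_P, of "\<lambda>v. \<alpha> ((map P vs)[i := v])"]
        linear_compose_scale_right[of "\<lambda>v. \<alpha> ((map P vs)[i := P v])" c]
      by (simp add: flip_def map_update o_def linear_compose_sub)
  qed
  then show ?thesis
    using assms by (simp add: alternating_forms_def flip_def distinct_map)
qed

text \<open>Here \<open>\<delta>\<alpha> = 0\<close>, and \<open>\<delta>d\<alpha>\<close> is built from the vectors \<open>[e, J\<^sub>u e]\<close>.  The deformed bracket is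
  \<open>[\<sigma>\<cdot>, \<cdot>]\<close>, so the deformed vector is \<open>[\<sigma>e, \<sigma>J\<^sub>u e]\<close>, and this equals \<open>[e, J\<^sub>u e]\<close> because \<open>\<sigma>\<close> is
  orthogonal and commutes with \<open>J\<close>.\<close>

lemma lie_laplacian_1:
  assumes "\<alpha> \<in> alternating_forms 1"
  shows "deformed.lie_laplacian \<alpha> = lie_laplacian \<alpha>"
proof
  fix vs
  note hom = alternating_homogeneous_form[OF assms]
  have anti: "lie_d J \<alpha> [y, x] = - lie_d J \<alpha> [x, y]" for x y
    using linear_neg[OF homogeneous_form_1_linear[OF hom]]
    by (simp add: lie_d_1[OF hom] bracket_antisym[of y x])
  have anti': "lie_d K \<alpha> [y, x] = - lie_d K \<alpha> [x, y]" for x y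
    using linear_neg[OF homogeneous_form_1_linear[OF hom]]
    by (simp add: deformed.lie_d_1[OF hom] deformed.bracket_antisym[of y x])
  have eq: "lie_delta K (lie_d K \<alpha>) [u] = lie_delta J (lie_d J \<alpha>) [u]" for u
  proof -
    have "lie_bracket K (e, 0) (K Z e, 0) = bracket (e, 0) (J Z e, 0)" for e Z
      by (simp add: deformed_bracket[of _ _ _ 0] bracket_sigma_sigma[of e 0 "J Z e" 0 0 0, symmetric]
          K_apply sigma_J)
    then show ?thesis
      unfolding lie_delta_2[OF homogeneous_form_lie_d_1[OF hom] anti]
        deformed.lie_delta_2[OF deformed.homogeneous_form_lie_d_1[OF hom] anti']
      by (simp add: lie_d_1[OF hom] deformed.lie_d_1[OF hom])
  qed
  show "deformed.lie_laplacian \<alpha> vs = lie_laplacian \<alpha> vs"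
  proof (cases "length vs = 1")
    case True
    then obtain u where "vs = [u]"
      unfolding length_1_conv by blast
    then show ?thesis
      by (simp add: lie_laplacian_def deformed.lie_laplacian_def lie_delta_1[OF hom]
          deformed.lie_delta_1[OF hom] eq lie_d_def)
  next
    case False
    then show ?thesis
      by (simp add: lie_laplacian_zero[OF hom] deformed.lie_laplacian_zero[OF hom])
  qed
qed

text \<open>Pairing \<open>\<alpha>\<close> with \<open>\<sigma>J\<^sub>u\<close> is pairing it with \<open>J\<^sub>u\<close>, except for the sign on \<open>\<vv>\<^sub>-\<close>, which the sign
  change of \<open>\<alpha>\<close> on \<open>\<Lambda>\<^sup>2 \<vv>\<^sub>-\<close> undoes.\<close>

lemma lie_delta_flip:
  assumes "\<alpha> \<in> alternating_forms 2"
  shows "lie_delta K (flip 2 \<sigma> \<alpha>) = lie_delta J \<alpha>"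
proof
  fix vs
  note hom = alternating_homogeneous_form[OF assms]
  note flip = flip_alternating[OF assms, of 2]
  have bil: "bilinear (\<lambda>x y. \<alpha> [x, y])"
    by (rule multilinear_bilinear[OF homogeneous_form_multilinear[OF hom]])
  show "lie_delta K (flip 2 \<sigma> \<alpha>) vs = lie_delta J \<alpha> vs"
  proof (cases "length vs = 1")
    case True
    then obtain u where vs: "vs = [u]"
      unfolding length_1_conv by blast
    let ?J = "J (snd u)"
    define T where "T X Y = \<alpha> [(X, 0), (?J Y, 0)]" for X Y
    have T: "bilinear T"
      unfolding T_def[abs_def] by (rule bilinear_compose[OF bil linear_left_summand linear_endo_left])
    have Tp: "bilinear (\<lambda>X Y. T X (p Y))"
      using T linear_compose[OF linear_p, of "T X" for X] by (simp add: bilinear_def o_def)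
    have "flip 2 \<sigma> \<alpha> [(e, 0), (K (snd u) e, 0)] = T e e - 2 * T e (p e) + 2 * T (p e) (p e)" for e
    proof -
      have "flip 2 \<sigma> \<alpha> [(e, 0), (K (snd u) e, 0)] = T e (\<sigma> e) - 2 * T (p e) (p (\<sigma> e))"
        by (simp add: flip_def K_apply T_def p_J)
      then show ?thesis
        unfolding p_sigma by (simp add: sigma_eq bilinear_rneg[OF T] bilinear_rsub[OF T] bilinear_rmul[OF T])
    qed
    moreover have "(\<Sum>e\<in>Basis. T (p e) (p e)) = (\<Sum>e\<in>Basis. T e (p e))"
      using trace_adjoint[OF Tp p_symmetric] by simp
    ultimately have "(\<Sum>e\<in>Basis. flip 2 \<sigma> \<alpha> [(e, 0), (K (snd u) e, 0)]) = (\<Sum>e\<in>Basis. T e e)"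
      by (simp add: sum.distrib sum_subtractf sum_distrib_left[symmetric])
    then show ?thesis
      unfolding vs lie_delta_2[OF hom alternating_2_antisym[OF assms]]
        deformed.lie_delta_2[OF alternating_homogeneous_form[OF flip] alternating_2_antisym[OF flip]]
      by (simp add: T_def)
  next
    case False
    then show ?thesis
      using homogeneous_form_zero[OF hom] homogeneous_form_zero[OF alternating_homogeneous_form[OF flip]]
      by (simp add: lie_delta_def)
  qed
qed

text \<open>The mirror image of \<open>lie_delta_flip\<close>: with \<open>\<sigma> = 1 - 2 P\<close> on \<open>\<vv>\<close>, the deformed bracket differs from the
  original one by \<open>- 2 [P u, v]\<close>, and this is \<open>- 2 [P u, P v]\<close> since \<open>P\<close> is a symmetric projection
  commuting with every \<open>J\<^sub>Z\<close>.\<close>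

lemma lie_d_flip:
  assumes "homogeneous_form 1 \<theta>"
  shows "lie_d K \<theta> [u, v] = flip 2 \<sigma> (lie_d J \<theta>) [u, v]"
proof -
  have "bracket (P u) (P v) = bracket (P u) v"
    by (simp add: lie_bracket_def p_symmetric[symmetric] p_J)
  moreover have "lie_bracket K u v = bracket u v - 2 *\<^sub>R bracket (P u) v"
  proof -
    have "lie_bracket K u v = bracket (u - 2 *\<^sub>R P u) v"
      by (simp add: lie_bracket_def K_apply sigma_eq)
    then show ?thesis
      by (simp only: linear_diff[OF linear_bracket_left] linear_scale[OF linear_bracket_left])
  qed
  moreover note linear_diff[OF homogeneous_form_1_linear[OF assms]] linear_scale[OF homogeneous_form_1_linear[OF assms]]
  ultimately show ?thesis
    by (simp add: flip_def lie_d_1[OF assms] deformed.lie_d_1[OF assms])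
qed

text \<open>Every term of \<open>\<delta>d\<alpha>\<close> evaluates \<open>\<alpha>\<close> on a bracket, which is central, so it does not see the
  sign change.  The deformation replaces \<open>e\<close> by \<open>\<sigma>e\<close> in both slots and leaves the trace alone.\<close>

lemma lie_delta_lie_d_flip:
  assumes "\<alpha> \<in> alternating_forms 2"
  shows "lie_delta K (lie_d K (flip 2 \<sigma> \<alpha>)) [u, v] = lie_delta J (lie_d J \<alpha>) [u, v]"
proof -
  note mult = homogeneous_form_multilinear[OF alternating_homogeneous_form[OF assms]]
  note \<alpha> = multilinear_bilinear[OF mult, of "[]"]
  have central: "flip 2 \<sigma> \<alpha> [x, y] = \<alpha> [x, y]" if "fst x = 0" for x y
    using bilinear_lzero[OF \<alpha>] that by (simp add: flip_def)
  have "deformed.delta_d_form (flip 2 \<sigma> \<alpha>) Z v e e = delta_d_form \<alpha> Z v (\<sigma> e) (\<sigma> e)" for Z v e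
    by (simp add: delta_d_form_def deformed.delta_d_form_def central deformed_bracket[of _ _ _ 0] K_apply)
  then show ?thesis
    unfolding lie_delta_lie_d_2[OF assms] deformed.lie_delta_lie_d_2[OF flip_alternating[OF assms]]
    by (simp add: trace_sigma[OF bilinear_delta_d_form[OF mult]])
qed

text \<open>\<open>\<delta>d\<alpha>(u, v)\<close> is a difference of terms containing \<open>J\<^sub>u\<close> and \<open>J\<^sub>v\<close>, which vanish for \<open>u\<close> and \<open>v\<close> in \<open>\<vv>\<close>; so
  \<open>\<delta>d\<alpha>\<close> has no component whose sign could change.\<close>

lemma lie_delta_lie_d_P:
  assumes "\<alpha> \<in> alternating_forms 2"
  shows "lie_delta J (lie_d J \<alpha>) [P u, P v] = 0"
proof -
  note \<alpha> = multilinear_bilinear[OF homogeneous_form_multilinear[OF alternating_homogeneous_form[OF assms]], of "[]"]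
  show ?thesis
    using bilinear_lzero[OF \<alpha>] bilinear_rzero[OF \<alpha>]
    by (simp add: lie_delta_lie_d_2[OF assms] delta_d_form_def zero_prod_def[symmetric])
qed

lemma lie_laplacian_flip:
  assumes "\<alpha> \<in> alternating_forms 2"
  shows "deformed.lie_laplacian (flip 2 \<sigma> \<alpha>) = flip 2 \<sigma> (lie_laplacian \<alpha>)"
proof
  fix vs
  note hom = alternating_homogeneous_form[OF assms]
  note flip = flip_alternating[OF assms, of 2]
  show "deformed.lie_laplacian (flip 2 \<sigma> \<alpha>) vs = flip 2 \<sigma> (lie_laplacian \<alpha>) vs"
  proof (cases "length vs = 2")
    case True
    then obtain u v where "vs = [u, v]"
      unfolding length_2_conv by blast
    then show ?thesis
      using lie_d_flip[OF homogeneous_form_lie_delta_2[OF hom alternating_2_antisym[OF assms]], of u v]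
        lie_delta_lie_d_flip[OF assms, of u v] lie_delta_lie_d_P[OF assms, of u v]
      by (simp add: lie_laplacian_def deformed.lie_laplacian_def lie_delta_flip[OF assms] flip_def)
  next
    case False
    then show ?thesis
      by (simp add: lie_laplacian_zero[OF hom] deformed.lie_laplacian_zero[OF alternating_homogeneous_form[OF flip]]
          flip_def)
  qed
qed

end

section \<open>Isospectrality\<close>

context sigma_deformation
begin

text \<open>The passage from the algebra back to the groups: evaluate at the origin, apply \<open>flip\<close>, and
  extend by the translations of the deformed group.\<close>

lemma isospectral_on_left_invariant_forms:
  assumes c: "c * c = 2 * c"
    and lap: "\<And>\<alpha>. \<alpha> \<in> alternating_forms k \<Longrightarrow>
      laplacian (left_invariant_metric J) (invariant_extension J \<alpha>) = invariant_extension J (lie_laplacian \<alpha>)"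
    and lap': "\<And>\<alpha>. \<alpha> \<in> alternating_forms k \<Longrightarrow>
      laplacian (left_invariant_metric K) (invariant_extension K \<alpha>) = invariant_extension K (deformed.lie_laplacian \<alpha>)"
    and intertwine: "\<And>\<alpha>. \<alpha> \<in> alternating_forms k \<Longrightarrow>
      deformed.lie_laplacian (flip c \<sigma> \<alpha>) = flip c \<sigma> (lie_laplacian \<alpha>)"
  shows "isospectral_on
    (left_invariant_forms J k) (laplacian (left_invariant_metric J))
    (left_invariant_forms K k) (laplacian (left_invariant_metric K))"
proof -
  define F where "F \<omega> = invariant_extension K (flip c \<sigma> (\<omega> 0))" for \<omega> :: "'v \<times> 'z \<Rightarrow> ('v \<times> 'z) list \<Rightarrow> real"
  have F: "F (invariant_extension J \<alpha>) = invariant_extension K (flip c \<sigma> \<alpha>)" for \<alpha>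
    by (simp add: F_def)
  note inv = flip_involution[OF c]
  have zero: "(r *\<^sub>R \<omega>) 0 = r *\<^sub>R \<omega> 0" for r and \<omega> :: "'v \<times> 'z \<Rightarrow> ('v \<times> 'z) list \<Rightarrow> real"
    by (simp add: scaleR_fun_def)
  show ?thesis
    unfolding left_invariant_forms_eq deformed.left_invariant_forms_eq
  proof (rule isospectral_on_transfer[where F = F])
    show "linear F"
      by (simp add: linear_iff F_def zero linear_add[OF linear_flip] linear_scale[OF linear_flip]
          linear_add[OF deformed.linear_invariant_extension] linear_scale[OF deformed.linear_invariant_extension])
    show "subspace (invariant_extension J ` alternating_forms k)"
      by (rule linear_subspace_image[OF linear_invariant_extension subspace_alternating_forms])
    show "subspace (range (invariant_extension J))"
      by (rule linear_subspace_image[OF linear_invariant_extension subspace_UNIV])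
    show "inj_on F (range (invariant_extension J))"
    proof (rule inj_onI, elim rangeE)
      fix \<omega> \<omega>' \<alpha> \<beta>
      assume eq: "F \<omega> = F \<omega>'" and \<omega>: "\<omega> = invariant_extension J \<alpha>" "\<omega>' = invariant_extension J \<beta>"
      have "flip c \<sigma> \<alpha> = flip c \<sigma> \<beta>"
        using eq by (simp add: \<omega> F deformed.invariant_extension_eq_iff)
      then have "flip c \<sigma> (flip c \<sigma> \<alpha>) = flip c \<sigma> (flip c \<sigma> \<beta>)"
        by simp
      then show "\<omega> = \<omega>'"
        by (simp add: inv \<omega>)
    qed
    have "flip c \<sigma> ` alternating_forms k = (alternating_forms k :: (('v \<times> 'z) list \<Rightarrow> real) set)"
    proof
      show "flip c \<sigma> ` alternating_forms k \<subseteq> (alternating_forms k :: (('v \<times> 'z) list \<Rightarrow> real) set)"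
        using flip_alternating by blast
      show "alternating_forms k \<subseteq> flip c \<sigma> ` (alternating_forms k :: (('v \<times> 'z) list \<Rightarrow> real) set)"
      proof
        fix \<alpha> :: "('v \<times> 'z) list \<Rightarrow> real"
        assume "\<alpha> \<in> alternating_forms k"
        then show "\<alpha> \<in> flip c \<sigma> ` alternating_forms k"
          using inv[of \<alpha>] flip_alternating[of \<alpha> k c] by (intro image_eqI[of _ _ "flip c \<sigma> \<alpha>"]) simp_all
      qed
    qed
    moreover have "F ` invariant_extension J ` alternating_forms k =
        invariant_extension K ` flip c \<sigma> ` alternating_forms k"
      by (simp add: image_image F)
    ultimately show "F ` invariant_extension J ` alternating_forms k = invariant_extension K ` alternating_forms k"
      by simp
  next
    fix \<omega> assume "\<omega> \<in> invariant_extension J ` alternating_forms k"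
    then obtain \<alpha> where \<alpha>: "\<alpha> \<in> alternating_forms k" and \<omega>: "\<omega> = invariant_extension J \<alpha>"
      by blast
    show "laplacian (left_invariant_metric K) (F \<omega>) = F (laplacian (left_invariant_metric J) \<omega>)"
      by (simp only: \<omega> F lap[OF \<alpha>] lap'[OF flip_alternating[OF \<alpha>]] intertwine[OF \<alpha>])
    show "laplacian (left_invariant_metric J) \<omega> \<in> range (invariant_extension J)"
      by (simp only: \<omega> lap[OF \<alpha>] rangeI)
  qed (rule image_mono[OF subset_UNIV])
qed

end

theorem proposition5:
  fixes J :: "'z::euclidean_space \<Rightarrow> 'v::euclidean_space \<Rightarrow> 'v" and \<sigma> :: "'v \<Rightarrow> 'v"
  assumes "metric_2step J"
    and "orthogonal_transformation \<sigma>" and "\<sigma> \<circ> \<sigma> = id"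
    and "\<And>Z. \<sigma> \<circ> J Z = J Z \<circ> \<sigma>"
  shows "isospectral_on
           (left_invariant_forms J 1)
           (laplacian (left_invariant_metric J))
           (left_invariant_forms (deformation \<sigma> J) 1)
           (laplacian (left_invariant_metric (deformation \<sigma> J)))
       \<and> isospectral_on
           (left_invariant_forms J 2)
           (laplacian (left_invariant_metric J))
           (left_invariant_forms (deformation \<sigma> J) 2)
           (laplacian (left_invariant_metric (deformation \<sigma> J)))"
proof -
  interpret sigma_deformation J \<sigma>
  proof (intro sigma_deformation.intro skew_pencil.intro sigma_deformation_axioms.intro)
    show "\<And>X. linear (\<lambda>Z. J Z X)" "\<And>Z. linear (J Z)" "\<And>Z X Y. J Z X \<bullet> Y = - (X \<bullet> J Z Y)"
      using assms(1) unfolding metric_2step_def by blast+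
  qed (fact assms(2-4))+
  show ?thesis
  proof (rule conjI)
    show "isospectral_on
        (left_invariant_forms J 1) (laplacian (left_invariant_metric J))
        (left_invariant_forms K 1) (laplacian (left_invariant_metric K))"
      by (rule isospectral_on_left_invariant_forms[of 0, OF _ laplacian_invariant_extension_1
            deformed.laplacian_invariant_extension_1])
        (simp_all add: lie_laplacian_1 del: One_nat_def)
    show "isospectral_on
        (left_invariant_forms J 2) (laplacian (left_invariant_metric J))
        (left_invariant_forms K 2) (laplacian (left_invariant_metric K))"
      by (rule isospectral_on_left_invariant_forms[of 2, OF _ laplacian_invariant_extension_2
            deformed.laplacian_invariant_extension_2])
        (simp_all add: lie_laplacian_flip)
  qed
qed

end
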